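(* Let $P$ be an ergodic transition matrix over a finite space $\mathcal{X}$ with generalized contraction coefficient $\kappa_\star$, $\mu$ a probability distribution on $\mathcal{X}$, $\delta\in(0,1)$, $\lambda\in(0,\infty)^{\mathcal{X}}$ a smoothing vector, $m\in\mathbb{N}$, and $X^m=X_1,\dots,X_m\sim(\mu,P)$. \begin{enumerate} \item[(a)] Let $S\in\mathbb{N}$. With probability at least $1-\delta$, $$\left|\widehat{\kappa}_{\star[S]}-\kappa_\star\right|\le\widehat{K}_{\lambda,\delta,S}(X^m),\qquad\widehat{K}_{\lambda,\delta,S}(X^m)=\frac1S+\max_{s\in[S]}\left\{\frac1s\widehat{W}^{(s)}_{\lambda,\delta/S}(X^m)\right\}.$$ \item[(b)] With probability at least $1-\delta$, $$\left|\widehat{\kappa}_\star-\kappa_\star\right|\le\widehat{K}_{\lambda,\delta}(X^m),\qquad\widehat{K}_{\lambda,\delta}(X^m)=\frac1{\widehat{S}}+\max_{s\in[\widehat{S}]}\left\{\frac1s\widehat{W}^{(s)}_{\lambda,\delta/(\lceil\sqrt m\rceil\widehat{S})}(X^m)\right\}.$$ \end{enumerate} Here $\widehat{\kappa}_{\star[S]}$ is the fixed-truncation estimator, and $\widehat S$, $\widehat{\kappa}_\star$ are the adaptive truncation and adaptive estimator, all defined in the context.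
   Context: $\mathbb{N}=\{1,2,\dots\}$, $[n]=\{1,\dots,n\}$, $\log$ is the natural logarithm. A row-stochastic matrix $P$ over a finite set $\mathcal{X}$ is ergodic if it is primitive. $X^m\sim(\mu,P)$ means a trajectory of length $m$ of the Markov chain with initial distribution $\mu$ and transition matrix $P$. $\|\mu-\nu\|_{\mathsf{TV}}=\frac12\sum_x|\mu(x)-\nu(x)|$. For a stochastic matrix $Q$, $\kappa(Q)=\max_{\mu,\nu}\|\mu Q-\nu Q\|_{\mathsf{TV}}$ over pairs of probability distributions; $\kappa_\star=1-\max_{s\in\mathbb{N}}\{(1-\kappa(P^s))/s\}$. For a sequence $Y^n=Y_1,\dots,Y_n$ in $\mathcal{X}$, put $N_x=\sum_{t=1}^{n-1}\mathbf{1}\{Y_t=x\}$, $N_{xx'}=\sum_{t=1}^{n-1}\mathbf{1}\{Y_t=x,Y_{t+1}=x'\}$, let $\widehat{P}_\lambda(Y^n)$ be the matrix with entries $\frac{N_{xx'}+\lambda(x)}{N_x+\lambda(x)|\mathcal{X}|}$, and $$\widehat{W}_{\lambda,\delta}(Y^n)=2\max_{x\in\mathcal{X}}\frac{\sum_{x'}\sqrt{N_{xx'}}+(3/\sqrt2)\sqrt{N_x}\sqrt{\log(2n|\mathcal{X}|/\delta)}+\lambda(x)|\mathcal{X}|}{N_x+\lambda(x)|\mathcal{X}|}.$$ For $s\in\mathbb{N}$, $X^m_{[s]}=X_1,X_{1+s},\dots,X_{1+\lfloor(m-1)/s\rfloor s}$ is the $s$-skipped trajectory (of length $1+\lfloor(m-1)/s\rfloor$;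 just $X_1$ if $s\ge m$), $\widehat{W}^{(s)}_{\lambda,\delta}(X^m)=\widehat{W}_{\lambda,\delta}(X^m_{[s]})$, and $\widehat{\kappa}_s(X^m)=\kappa(\widehat{P}_\lambda(X^m_{[s]}))$. For $S\in\mathbb{N}$, $\widehat{\kappa}_{\star[S]}=1-\max_{s\in[S]}\{(1-\widehat{\kappa}_s(X^m))/s\}$. Fix a non-decreasing $\phi:\mathbb{N}\to\mathbb{N}$ with $\lim_{m\to\infty}\phi(m)=+\infty$; then $$\widehat{S}=\widehat{S}(X^m)=\left\lceil\frac{1}{\max_{s\in[\phi(m)]}\{\frac1s\widehat{W}^{(s)}_{\lambda,\delta}(X^m)\}}\right\rceil,\qquad\widehat{\kappa}_\star=\widehat{\kappa}_{\star[\widehat{S}]}.$$ *)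

theory Defs
  imports "HOL-Probability.Probability"
begin

text \<open>
  The finite space is a type \<open>'x\<close> of class \<^class>\<open>finite\<close>; distributions and transition matrices over
  it are vectors and matrices with real entries, distributions acting from the left through
  \<open>\<mu> v* Q\<close>. The natural numbers of the source start at 1, which is expressed by explicit bounds.
\<close>

definition prob_vec :: "real ^ 'x::finite \<Rightarrow> bool" where
  "prob_vec \<mu> \<longleftrightarrow> (\<forall>x. 0 \<le> \<mu> $ x) \<and> (\<Sum>x\<in>UNIV. \<mu> $ x) = 1"

definition row_stochastic :: "real ^ 'x ^ 'x::finite \<Rightarrow> bool" where
  "row_stochastic P \<longleftrightarrow> (\<forall>x. prob_vec (P $ x))"

text \<open>The library's power on the type \<open>real ^ 'x ^ 'x\<close> is taken entrywise, so the matrix power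
  needs its own constant.\<close>

primrec mat_pow :: "real ^ 'x ^ 'x::finite \<Rightarrow> nat \<Rightarrow> real ^ 'x ^ 'x" where
  "mat_pow P 0 = mat 1"
| "mat_pow P (Suc k) = mat_pow P k ** P"

definition primitive :: "real ^ 'x ^ 'x::finite \<Rightarrow> bool" where
  "primitive P \<longleftrightarrow> (\<exists>k\<ge>1. \<forall>x y. 0 < mat_pow P k $ x $ y)"

definition ergodic :: "real ^ 'x ^ 'x::finite \<Rightarrow> bool" where
  "ergodic P \<longleftrightarrow> row_stochastic P \<and> primitive P"

definition tv_dist :: "real ^ 'x::finite \<Rightarrow> real ^ 'x \<Rightarrow> real" where
  "tv_dist \<mu> \<nu> = 1 / 2 * (\<Sum>x\<in>UNIV. \<bar>\<mu> $ x - \<nu> $ x\<bar>)"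

text \<open>The two maxima below range over infinite sets, for which \<^const>\<open>Max\<close> is meaningless; they are
  written as suprema. Both suprema are attained, see \<open>contraction_coeff_attained\<close> and
  \<open>gen_contraction_coeff_attained\<close>.\<close>

definition contraction_coeff :: "real ^ 'x ^ 'x::finite \<Rightarrow> real" where
  "contraction_coeff Q =
     Sup {tv_dist (\<mu> v* Q) (\<nu> v* Q) | \<mu> \<nu>. prob_vec \<mu> \<and> prob_vec \<nu>}"

definition gen_contraction_coeff :: "real ^ 'x ^ 'x::finite \<Rightarrow> real" where
  "gen_contraction_coeff P =
     1 - (SUP s\<in>{1::nat..}. (1 - contraction_coeff (mat_pow P s)) / real s)"

text \<open>\<open>X 1, \<dots>, X m\<close> are random variables on \<open>M\<close> whose joint law is that of the first \<open>m\<close> steps of the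
  Markov chain with initial distribution \<open>\<mu>\<close> and transition matrix \<open>P\<close>. Nothing is required of
  \<open>X t\<close> for other times \<open>t\<close>.\<close>

definition markov_trajectory ::
  "'w measure \<Rightarrow> nat \<Rightarrow> real ^ 'x \<Rightarrow> real ^ 'x ^ 'x \<Rightarrow> (nat \<Rightarrow> 'w \<Rightarrow> 'x::finite) \<Rightarrow> bool" where
  "markov_trajectory M m \<mu> P X \<longleftrightarrow>
     (\<forall>t\<in>{1..m}. X t \<in> measurable M (count_space UNIV)) \<and>
     (\<forall>x. measure M {\<omega> \<in> space M. \<forall>t\<in>{1..m}. X t \<omega> = x t} =
            \<mu> $ x 1 * (\<Prod>t = 1..<m. P $ x t $ x (t + 1)))"

text \<open>A sequence \<open>Y 1, \<dots>, Y n\<close> is given by its length \<open>n\<close> and a function \<open>Y\<close> on the natural numbers,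
  whose values outside \<open>{1..n}\<close> are never used.\<close>

definition visits :: "nat \<Rightarrow> (nat \<Rightarrow> 'x) \<Rightarrow> 'x \<Rightarrow> nat" where
  "visits n Y x = card {t \<in> {1..<n}. Y t = x}"

definition transitions :: "nat \<Rightarrow> (nat \<Rightarrow> 'x) \<Rightarrow> 'x \<Rightarrow> 'x \<Rightarrow> nat" where
  "transitions n Y x x' = card {t \<in> {1..<n}. Y t = x \<and> Y (t + 1) = x'}"

definition P_hat :: "real ^ 'x \<Rightarrow> nat \<Rightarrow> (nat \<Rightarrow> 'x::finite) \<Rightarrow> real ^ 'x ^ 'x" where
  "P_hat lam n Y =
     (\<chi> x x'. (real (transitions n Y x x') + lam $ x) / (real (visits n Y x) + lam $ x * real CARD('x)))"

definition W_hat :: "real ^ 'x \<Rightarrow> real \<Rightarrow> nat \<Rightarrow> (nat \<Rightarrow> 'x::finite) \<Rightarrow> real" where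
  "W_hat lam \<delta> n Y =
     2 * (MAX x.
       ((\<Sum>x'\<in>UNIV. sqrt (real (transitions n Y x x')))
         + (3 / sqrt 2) * sqrt (real (visits n Y x)) * sqrt (ln (2 * real n * real CARD('x) / \<delta>))
         + lam $ x * real CARD('x))
       / (real (visits n Y x) + lam $ x * real CARD('x)))"

definition skip_len :: "nat \<Rightarrow> nat \<Rightarrow> nat" where
  "skip_len s m = 1 + (m - 1) div s"

definition skip :: "nat \<Rightarrow> (nat \<Rightarrow> 'x) \<Rightarrow> nat \<Rightarrow> 'x" where
  "skip s X = (\<lambda>i. X (1 + (i - 1) * s))"

definition W_hat_skip :: "nat \<Rightarrow> real ^ 'x \<Rightarrow> real \<Rightarrow> nat \<Rightarrow> (nat \<Rightarrow> 'x::finite) \<Rightarrow> real" where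
  "W_hat_skip s lam \<delta> m X = W_hat lam \<delta> (skip_len s m) (skip s X)"

definition kappa_hat_skip :: "nat \<Rightarrow> real ^ 'x \<Rightarrow> nat \<Rightarrow> (nat \<Rightarrow> 'x::finite) \<Rightarrow> real" where
  "kappa_hat_skip s lam m X = contraction_coeff (P_hat lam (skip_len s m) (skip s X))"

definition kappa_hat_trunc :: "real ^ 'x \<Rightarrow> nat \<Rightarrow> nat \<Rightarrow> (nat \<Rightarrow> 'x::finite) \<Rightarrow> real" where
  "kappa_hat_trunc lam S m X =
     1 - (MAX s\<in>{1..S}. (1 - kappa_hat_skip s lam m X) / real s)"

definition K_hat_trunc :: "real ^ 'x \<Rightarrow> real \<Rightarrow> nat \<Rightarrow> nat \<Rightarrow> (nat \<Rightarrow> 'x::finite) \<Rightarrow> real" where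
  "K_hat_trunc lam \<delta> S m X =
     1 / real S + (MAX s\<in>{1..S}. 1 / real s * W_hat_skip s lam (\<delta> / real S) m X)"

definition S_hat :: "(nat \<Rightarrow> nat) \<Rightarrow> real ^ 'x \<Rightarrow> real \<Rightarrow> nat \<Rightarrow> (nat \<Rightarrow> 'x::finite) \<Rightarrow> nat" where
  "S_hat \<phi> lam \<delta> m X =
     nat \<lceil>1 / (MAX s\<in>{1..\<phi> m}. 1 / real s * W_hat_skip s lam \<delta> m X)\<rceil>"

definition kappa_hat_adaptive ::
  "(nat \<Rightarrow> nat) \<Rightarrow> real ^ 'x \<Rightarrow> real \<Rightarrow> nat \<Rightarrow> (nat \<Rightarrow> 'x::finite) \<Rightarrow> real" where
  "kappa_hat_adaptive \<phi> lam \<delta> m X = kappa_hat_trunc lam (S_hat \<phi> lam \<delta> m X) m X"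

definition K_hat_adaptive ::
  "(nat \<Rightarrow> nat) \<Rightarrow> real ^ 'x \<Rightarrow> real \<Rightarrow> nat \<Rightarrow> (nat \<Rightarrow> 'x::finite) \<Rightarrow> real" where
  "K_hat_adaptive \<phi> lam \<delta> m X =
     (let S = S_hat \<phi> lam \<delta> m X in
       1 / real S +
       (MAX s\<in>{1..S}. 1 / real s *
          W_hat_skip s lam (\<delta> / (of_int \<lceil>sqrt (real m)\<rceil> * real S)) m X))"

lemma contraction_coeff_attained:
  fixes Q :: "real ^ 'x ^ 'x::finite"
  shows "\<exists>\<mu> \<nu>. prob_vec \<mu> \<and> prob_vec \<nu> \<and> contraction_coeff Q = tv_dist (\<mu> v* Q) (\<nu> v* Q) \<and>
    (\<forall>\<mu>' \<nu>'. prob_vec \<mu>' \<longrightarrow> prob_vec \<nu>' \<longrightarrow> tv_dist (\<mu>' v* Q) (\<nu>' v* Q) \<le> contraction_coeff Q)"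
proof -
  let ?D = "{\<mu> :: real ^ 'x. prob_vec \<mu>}"
  let ?f = "\<lambda>p. tv_dist (fst p v* Q) (snd p v* Q)"
  have "?D = (\<Inter>x. {\<mu>. 0 \<le> \<mu> $ x}) \<inter> {\<mu>. (\<Sum>x\<in>UNIV. \<mu> $ x) = 1}"
    by (auto simp: prob_vec_def)
  also have "closed \<dots>"
    by (intro closed_Int closed_INT ballI closed_Collect_le closed_Collect_eq continuous_intros)
  finally have "closed ?D" .
  moreover have "norm \<mu> \<le> 1" if "prob_vec \<mu>" for \<mu> :: "real ^ 'x"
    using norm_le_l1_cart[of \<mu>] that by (simp add: prob_vec_def)
  then have "bounded ?D"
    by (auto simp: bounded_iff)
  ultimately have "compact (?D \<times> ?D)"
    by (intro compact_Times) (auto simp: compact_eq_bounded_closed)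
  moreover have "axis undefined 1 \<in> ?D"
    by (auto simp: prob_vec_def axis_def)
  then have "?D \<times> ?D \<noteq> {}" by blast
  moreover have "continuous_on (?D \<times> ?D) ?f"
    unfolding tv_dist_def vector_matrix_mult_def by (auto intro!: continuous_intros)
  ultimately obtain p where p: "p \<in> ?D \<times> ?D" "\<forall>q\<in>?D \<times> ?D. ?f q \<le> ?f p"
    using continuous_attains_sup[of "?D \<times> ?D" ?f] by blast
  have "contraction_coeff Q = ?f p"
    unfolding contraction_coeff_def
  proof (rule cSup_eq_maximum)
    show "?f p \<in> {tv_dist (\<mu> v* Q) (\<nu> v* Q) | \<mu> \<nu>. prob_vec \<mu> \<and> prob_vec \<nu>}"
      using p(1) unfolding mem_Collect_eq
      by (intro exI[of _ "fst p"] exI[of _ "snd p"]) (auto simp: mem_Times_iff)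
  qed (use p(2) in auto)
  then show ?thesis
    using p by (intro exI[of _ "fst p"] exI[of _ "snd p"]) auto
qed

lemma contraction_coeff_nonneg: "0 \<le> contraction_coeff Q"
proof -
  obtain \<mu> \<nu> where "contraction_coeff Q = tv_dist (\<mu> v* Q) (\<nu> v* Q)"
    using contraction_coeff_attained by blast
  moreover have "0 \<le> tv_dist (\<mu> v* Q) (\<nu> v* Q)"
    by (simp add: tv_dist_def sum_nonneg)
  ultimately show ?thesis by simp
qed

lemma prob_vec_mult:
  assumes "prob_vec \<mu>" "row_stochastic Q"
  shows "prob_vec (\<mu> v* Q)"
proof -
  have "(\<Sum>j\<in>UNIV. \<Sum>i\<in>UNIV. \<mu> $ i * Q $ i $ j) = (\<Sum>i\<in>UNIV. \<mu> $ i * (\<Sum>j\<in>UNIV. Q $ i $ j))"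
    by (subst sum.swap) (simp add: sum_distrib_left)
  with assms show ?thesis
    by (auto simp: prob_vec_def row_stochastic_def vector_matrix_mult_def intro!: sum_nonneg)
qed

lemma row_stochastic_mat_pow:
  assumes "row_stochastic P"
  shows "row_stochastic (mat_pow P s)"
proof (induction s)
  case 0
  show ?case by (auto simp: row_stochastic_def prob_vec_def mat_def)
next
  case (Suc s)
  have "mat_pow P (Suc s) $ x = mat_pow P s $ x v* P" for x
    by (simp add: vec_eq_iff matrix_matrix_mult_def vector_matrix_mult_def)
  with Suc assms show ?case
    by (auto simp: row_stochastic_def intro: prob_vec_mult)
qed

lemma contraction_coeff_le_1:
  assumes "row_stochastic Q"
  shows "contraction_coeff Q \<le> 1"
proof -
  obtain \<mu> \<nu> where *: "prob_vec \<mu>" "prob_vec \<nu>" "contraction_coeff Q = tv_dist (\<mu> v* Q) (\<nu> v* Q)"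
    using contraction_coeff_attained by blast
  have "prob_vec (\<mu> v* Q)" "prob_vec (\<nu> v* Q)"
    using * assms by (auto intro: prob_vec_mult)
  moreover have "(\<Sum>x\<in>UNIV. \<bar>a $ x - b $ x\<bar>) \<le> (\<Sum>x\<in>UNIV. a $ x) + (\<Sum>x\<in>UNIV. b $ x)"
    if "prob_vec a" "prob_vec b" for a b :: "real ^ 'a"
    unfolding sum.distrib[symmetric] using that
    by (intro sum_mono) (smt (verit) prob_vec_def)
  ultimately show ?thesis
    using * by (fastforce simp: tv_dist_def prob_vec_def)
qed

lemma gen_contraction_coeff_attained:
  assumes "row_stochastic P"
  shows "\<exists>s\<ge>1. gen_contraction_coeff P = 1 - (1 - contraction_coeff (mat_pow P s)) / real s \<and>
    (\<forall>r\<ge>1. (1 - contraction_coeff (mat_pow P r)) / real r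
             \<le> (1 - contraction_coeff (mat_pow P s)) / real s)"
proof -
  define g where "g s = (1 - contraction_coeff (mat_pow P s)) / real s" for s
  have g0: "0 \<le> g s" for s
    using contraction_coeff_le_1[OF row_stochastic_mat_pow[OF assms]] by (simp add: g_def)
  have g1: "g s \<le> 1 / real s" for s
    using contraction_coeff_nonneg[of "mat_pow P s"] by (simp add: g_def divide_right_mono)
  have "\<exists>s\<ge>1. \<forall>r\<ge>1. g r \<le> g s"
  proof (cases "\<exists>s\<ge>1. 0 < g s")
    case True
    then obtain s where s: "s \<ge> 1" "0 < g s" by blast
    define N where "N = Suc (max s (nat \<lceil>1 / g s\<rceil>))"
    obtain t where t: "t \<in> {1..N}" "\<forall>r\<in>{1..N}. g r \<le> g t"
      using Max_in[of "g ` {1..N}"] Max_ge[of "g ` {1..N}"] by (fastforce simp: N_def)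
    have "g r \<le> g t" if "r \<ge> 1" for r
    proof (cases "r \<le> N")
      case False
      then have "1 / g s \<le> real r" unfolding N_def by linarith
      then have "1 / real r \<le> g s" using s that by (simp add: field_simps)
      with g1[of r] have "g r \<le> g s" by linarith
      also have "\<dots> \<le> g t" using t s by (simp add: N_def)
      finally show ?thesis .
    qed (use t that in auto)
    with t show ?thesis by auto
  next
    case False
    then show ?thesis using g0 by (meson le_refl not_less order_trans)
  qed
  then obtain s where s: "s \<ge> 1" "\<forall>r\<ge>1. g r \<le> g s" by blast
  have "(SUP s\<in>{1::nat..}. g s) = g s"
    using s by (intro cSup_eq_maximum) auto
  with s show ?thesis
    by (auto simp: gen_contraction_coeff_def g_def)
qed

end

theory Submission
  imports Defs
begin

text \<open>
  The first \<open>k\<close> successors of a state \<open>x\<close> are stochastically no worse than an i.i.d. sample from the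
  row \<open>Q $ x\<close>, so it suffices to study the counts \<open>N\<^sub>y\<close> of \<open>k\<close> independent draws from a
  distribution \<open>p\<close> and to take a union bound over \<open>x\<close> and \<open>k\<close>. The statistic
  \<open>\<Sum>\<^sub>y (\<bar>N\<^sub>y - k p\<^sub>y\<bar> - 2 \<surd>N\<^sub>y)\<close> has nonpositive mean, since
  \<open>E \<bar>N\<^sub>y - k p\<^sub>y\<bar> \<le> 2 k p\<^sub>y / \<surd>(1 + k p\<^sub>y) \<le> 2 E \<surd>N\<^sub>y\<close>, and it changes by at most 4 when a
  single draw is replaced, so bounded differences give its upper tail. This bounds the
  row-wise \<open>\<ell>\<^sub>1\<close> error of the estimated matrix by \<open>W_hat\<close>, and \<open>contraction_coeff\<close> is
  1-Lipschitz in that error. A skipped trajectory is a Markov chain for the matrix power, and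
  truncating the maximum over \<open>s\<close> at \<open>S\<close> costs at most \<open>1 / S\<close>. For the adaptive estimator,
  \<open>W_hat \<ge> 1 / \<surd>n\<close> forces \<open>S_hat \<le> \<lceil>\<surd>m\<rceil>\<close>, so a union bound over that many truncations suffices.
\<close>

section \<open>Bounded differences for i.i.d. counts\<close>

text \<open>Hoeffding's lemma on the range of \<open>h\<close>, an interval of length at most
  \<open>C\<close>, with the vector turned into a pmf. The mean stays in the exponent, the form in
  which \<open>iid_expect_exp_le\<close> uses it once per draw.\<close>

lemma Hoeffding_prob_vec:
  fixes p :: "real ^ 'x::finite" and h :: "'x \<Rightarrow> real"
  assumes p: "prob_vec p" and C: "\<And>y z. h y - h z \<le> C" and l: "0 < l"
  shows "(\<Sum>y\<in>UNIV. p $ y * exp (l * h y)) \<le> exp (l * (\<Sum>y\<in>UNIV. p $ y * h y) + l\<^sup>2 * C\<^sup>2 / 8)"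
proof -
  define q where "q = embed_pmf (\<lambda>y. p $ y)"
  have pmf: "pmf q y = p $ y" for y
    unfolding q_def using p
    by (intro pmf_embed_pmf) (auto simp: prob_vec_def nn_integral_count_space_finite sum_ennreal)
  have E: "measure_pmf.expectation q g = (\<Sum>y\<in>UNIV. p $ y * g y)" for g :: "'x \<Rightarrow> real"
    by (subst integral_measure_pmf_real[of UNIV]) (auto simp: pmf mult.commute)
  define a where "a = Min (range h)"
  define b where "b = Max (range h)"
  have "b \<in> range h" "a \<in> range h"
    unfolding a_def b_def by (intro Max_in Min_in; simp)+
  then have "b - a \<le> C" using C by blast
  \<comment> \<open>The bound on \<open>b - a\<close> may be squared because \<open>b - a\<close> is
    nonnegative.\<close>
  moreover have "a \<le> b" unfolding a_def b_def
    by (meson Max_ge Min_le finite finite_imageI order_trans rangeI)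
  ultimately have C2: "(b - a)\<^sup>2 \<le> C\<^sup>2" by (intro power_mono) auto
  interpret interval_bounded_random_variable "measure_pmf q" h a b
    by unfold_locales (auto simp: a_def b_def)
  define mu where "mu = (\<Sum>y\<in>UNIV. p $ y * h y)"
  have "ennreal (measure_pmf.expectation q (\<lambda>x. exp (l * (h x - mu)))) =
      (\<integral>\<^sup>+ x. ennreal (exp (l * (h x - mu))) \<partial>measure_pmf q)"
    by (intro nn_integral_eq_integral[symmetric] integrable_measure_pmf_finite) auto
  also have "\<dots> \<le> ennreal (exp (l\<^sup>2 * (b - a)\<^sup>2 / 8))"
    using Hoeffdings_lemma_nn_integral[OF l] by (simp add: E mu_def)
  finally have "measure_pmf.expectation q (\<lambda>x. exp (l * (h x - mu))) \<le> exp (l\<^sup>2 * (b - a)\<^sup>2 / 8)"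
    by simp
  also have "\<dots> \<le> exp (l\<^sup>2 * C\<^sup>2 / 8)"
    using C2 by (simp add: mult_left_mono)
  finally have "(\<Sum>y\<in>UNIV. p $ y * exp (l * (h y - mu))) \<le> exp (l\<^sup>2 * C\<^sup>2 / 8)"
    by (simp add: E)
  then have "exp (l * mu) * (\<Sum>y\<in>UNIV. p $ y * exp (l * (h y - mu)))
      \<le> exp (l * mu) * exp (l\<^sup>2 * C\<^sup>2 / 8)"
    by (intro mult_left_mono) auto
  moreover have "exp (l * mu) * (\<Sum>y\<in>UNIV. p $ y * exp (l * (h y - mu))) =
      (\<Sum>y\<in>UNIV. p $ y * exp (l * h y))"
    by (simp add: sum_distrib_left right_diff_distrib exp_diff)
  ultimately show ?thesis unfolding exp_add mu_def[symmetric] by argo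
qed

text \<open>\<open>iid_expect p k g c\<close> is the expectation of \<open>g\<close> at the histogram obtained from the histogram
  \<open>c\<close> by adding \<open>k\<close> independent samples from \<open>p\<close>.\<close>

primrec iid_expect :: "real ^ 'x::finite \<Rightarrow> nat \<Rightarrow> (('x \<Rightarrow> nat) \<Rightarrow> real) \<Rightarrow> ('x \<Rightarrow> nat) \<Rightarrow> real" where
  "iid_expect p 0 g c = g c"
| "iid_expect p (Suc k) g c = (\<Sum>y\<in>UNIV. p $ y * iid_expect p k g (c(y := Suc (c y))))"

lemma iid_expect_mono:
  assumes "prob_vec p" "\<And>c. g c \<le> h c"
  shows "iid_expect p k g c \<le> iid_expect p k h c"
  by (induction k arbitrary: c)
    (use assms in \<open>auto intro!: sum_mono mult_left_mono simp: prob_vec_def\<close>)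

lemma iid_expect_const: "prob_vec p \<Longrightarrow> iid_expect p k (\<lambda>_. a) c = a"
  by (induction k arbitrary: c) (auto simp: prob_vec_def simp flip: sum_distrib_right)

lemma iid_expect_add:
  "iid_expect p k (\<lambda>c. g c + h c) c = iid_expect p k g c + iid_expect p k h c"
  by (induction k arbitrary: c) (auto simp: distrib_left sum.distrib)

lemma iid_expect_cmult: "iid_expect p k (\<lambda>c. a * g c) c = a * iid_expect p k g c"
  by (induction k arbitrary: c) (auto simp: sum_distrib_left mult_ac)

lemma iid_expect_sum:
  assumes "prob_vec p" "finite A"
  shows "iid_expect p k (\<lambda>c. \<Sum>i\<in>A. g i c) c = (\<Sum>i\<in>A. iid_expect p k (g i) c)"
  using assms(2) by (induction A) (auto simp: iid_expect_const[OF assms(1)] iid_expect_add)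

lemma iid_expect_nonneg:
  assumes "prob_vec p" "\<And>c. 0 \<le> g c"
  shows "0 \<le> iid_expect p k g c"
  using iid_expect_mono[OF assms(1), of "\<lambda>_. 0" g k c] assms(2) iid_expect_const[OF assms(1)] by simp

text \<open>Draws enter the histogram in any order, so replacing the first one amounts to replacing
  one in the final histogram, and averaging over the rest preserves the bound.\<close>

lemma iid_expect_diff_le:
  assumes "prob_vec p" "\<And>c y z. f (c(y := Suc (c y))) - f (c(z := Suc (c z))) \<le> (C::real)"
  shows "iid_expect p k f (c(y := Suc (c y))) - iid_expect p k f (c(z := Suc (c z))) \<le> C"
proof (induction k arbitrary: c)
  case (Suc k)
  let ?u = "\<lambda>w::'a. c(w := Suc (c w))"
  have swap: "(?u y)(w := Suc (?u y w)) = (?u w)(y := Suc (?u w y))" for y w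
    by (auto simp: fun_eq_iff)
  have "iid_expect p (Suc k) f (?u y) - iid_expect p (Suc k) f (?u z) =
      (\<Sum>w\<in>UNIV. p $ w * (iid_expect p k f ((?u w)(y := Suc (?u w y)))
        - iid_expect p k f ((?u w)(z := Suc (?u w z)))))"
    unfolding iid_expect.simps swap by (simp add: right_diff_distrib sum_subtractf)
  also have "\<dots> \<le> (\<Sum>w\<in>UNIV. p $ w * C)"
    using assms(1) by (intro sum_mono mult_left_mono Suc) (simp add: prob_vec_def)
  also have "\<dots> = C" using assms(1) by (simp add: prob_vec_def flip: sum_distrib_right)
  finally show ?case .
qed (use assms(2) in simp)

text \<open>The martingale argument behind bounded differences. As a function of the first draw, the
  expectation over the remaining ones oscillates by at most \<open>C\<close>, so each draw costs one
  factor \<open>exp (l^2 * C^2 / 8)\<close>.\<close>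

lemma iid_expect_exp_le:
  assumes p: "prob_vec p"
    and C: "\<And>c y z. f (c(y := Suc (c y))) - f (c(z := Suc (c z))) \<le> (C::real)" and l: "0 < l"
  shows "iid_expect p k (\<lambda>c. exp (l * f c)) c \<le> exp (l * iid_expect p k f c + real k * (l\<^sup>2 * C\<^sup>2 / 8))"
proof (induction k arbitrary: c)
  case (Suc k)
  let ?u = "\<lambda>w. c(w := Suc (c w))" and ?r = "l\<^sup>2 * C\<^sup>2 / 8"
  have "iid_expect p (Suc k) (\<lambda>c. exp (l * f c)) c
      \<le> (\<Sum>y\<in>UNIV. p $ y * exp (l * iid_expect p k f (?u y) + real k * ?r))"
    using p Suc by (auto intro!: sum_mono mult_left_mono simp: prob_vec_def)
  also have "\<dots> = exp (real k * ?r) * (\<Sum>y\<in>UNIV. p $ y * exp (l * iid_expect p k f (?u y)))"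
    unfolding sum_distrib_left exp_add by (intro sum.cong) (simp_all only: mult_ac)
  also have "\<dots> \<le> exp (real k * ?r) * exp (l * (\<Sum>y\<in>UNIV. p $ y * iid_expect p k f (?u y)) + ?r)"
    by (intro mult_left_mono Hoeffding_prob_vec[OF p _ l] iid_expect_diff_le[where f = f, OF p C]) auto
  also have "\<dots> = exp (l * iid_expect p (Suc k) f c + real (Suc k) * ?r)"
    by (simp add: exp_add [symmetric] algebra_simps)
  finally show ?case .
qed simp

text \<open>Chernoff's method: the indicator is bounded by \<open>exp (l * (f c - t))\<close>, and
  the nonpositive mean is dropped from the exponent.\<close>

lemma iid_expect_tail_le:
  assumes p: "prob_vec p"
    and C: "\<And>c y z. f (c(y := Suc (c y))) - f (c(z := Suc (c z))) \<le> (C::real)"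
    and "0 < C" "0 < k" "0 \<le> t" and mean: "iid_expect p k f c \<le> 0"
  shows "iid_expect p k (\<lambda>c. of_bool (t < f c)) c \<le> exp (- 2 * t\<^sup>2 / (real k * C\<^sup>2))"
\<comment> \<open>At \<open>t = 0\<close> the exponent \<open>l\<close> chosen below would vanish,
  while Hoeffding's lemma asks for \<open>0 < l\<close>; the claimed bound is then 1.\<close>
proof (cases "t = 0")
  case True
  have "iid_expect p k (\<lambda>c. of_bool (t < f c)) c \<le> iid_expect p k (\<lambda>_. 1) c"
    by (intro iid_expect_mono p) auto
  with True show ?thesis by (simp add: iid_expect_const[OF p])
next
  case False
  \<comment> \<open>The minimizer of \<open>- l * t + k * (l^2 * C^2 / 8)\<close>.\<close>
  define l where "l = 4 * t / (real k * C\<^sup>2)"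
  have l: "0 < l" using assms False by (simp add: l_def)
  have "iid_expect p k (\<lambda>c. of_bool (t < f c)) c \<le> iid_expect p k (\<lambda>c. exp (- l * t) * exp (l * f c)) c"
    using l by (intro iid_expect_mono p) (auto simp flip: exp_add)
  also have "\<dots> \<le> exp (- l * t) * exp (l * iid_expect p k f c + real k * (l\<^sup>2 * C\<^sup>2 / 8))"
    unfolding iid_expect_cmult by (intro mult_left_mono iid_expect_exp_le p C l) auto
  also have "\<dots> \<le> exp (- l * t + real k * (l\<^sup>2 * C\<^sup>2 / 8))"
    using mult_nonneg_nonpos[of l, OF _ mean] l by (simp flip: exp_add)
  also have "- l * t + real k * (l\<^sup>2 * C\<^sup>2 / 8) = - 2 * t\<^sup>2 / (real k * C\<^sup>2)"
    using assms by (simp add: l_def field_simps power2_eq_square)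
  finally show ?thesis .
qed

section \<open>Moments of a single count\<close>

lemma iid_expect_count:
  assumes p: "prob_vec p"
  shows "iid_expect p k (\<lambda>c. real (c y)) c = real (c y) + k * p $ y"
proof (induction k arbitrary: c)
  case (Suc k)
  have "p $ w * (real ((c(w := Suc (c w))) y) + k * p $ y) =
      p $ w * (real (c y) + k * p $ y) + (if w = y then p $ y else 0)" for w
    by (auto simp: algebra_simps)
  then show ?case using p
    by (simp add: Suc sum.distrib prob_vec_def algebra_simps flip: sum_distrib_right sum_distrib_left)
qed simp

text \<open>The count is binomial, shifted by \<open>c y\<close>: squared mean plus variance. The
  start \<open>c\<close> stays arbitrary because the induction absorbs one draw into it.\<close>

lemma iid_expect_count_sq:
  assumes p: "prob_vec p"
  shows "iid_expect p k (\<lambda>c. (real (c y))\<^sup>2) c =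
    (real (c y) + k * p $ y)\<^sup>2 + k * p $ y * (1 - p $ y)"
proof (induction k arbitrary: c)
  case (Suc k)
  let ?q = "p $ y"
  have "p $ w * ((real ((c(w := Suc (c w))) y) + k * ?q)\<^sup>2 + k * ?q * (1 - ?q)) =
      p $ w * ((real (c y) + k * ?q)\<^sup>2 + k * ?q * (1 - ?q))
        + (if w = y then ?q * (2 * (real (c y) + k * ?q) + 1) else 0)" for w
    by (auto simp: algebra_simps power2_eq_square)
  then have "iid_expect p (Suc k) (\<lambda>c. (real (c y))\<^sup>2) c =
      (\<Sum>w\<in>UNIV. p $ w) * ((real (c y) + k * ?q)\<^sup>2 + k * ?q * (1 - ?q))
        + ?q * (2 * (real (c y) + k * ?q) + 1)"
    by (simp add: Suc sum.distrib sum_distrib_right)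
  also have "\<dots> = (real (c y) + Suc k * ?q)\<^sup>2 + Suc k * ?q * (1 - ?q)"
    using p by (simp add: prob_vec_def algebra_simps power2_eq_square)
  finally show ?case .
qed simp

text \<open>All draws must miss \<open>y\<close>, and a positive start never returns to 0. This
  serves the small-mean case of \<open>iid_expect_abs_dev_le\<close>.\<close>

lemma iid_expect_count_zero:
  assumes p: "prob_vec p"
  shows "iid_expect p k (\<lambda>c. of_bool (c y = 0)) c = of_bool (c y = 0) * (1 - p $ y) ^ k"
proof (induction k arbitrary: c)
  case (Suc k)
  have "p $ w * (of_bool ((c(w := Suc (c w))) y = 0) * (1 - p $ y) ^ k) =
      p $ w * (of_bool (c y = 0) * (1 - p $ y) ^ k)
        - (if w = y then p $ y * (of_bool (c y = 0) * (1 - p $ y) ^ k) else 0)" for w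
    by auto
  then have "iid_expect p (Suc k) (\<lambda>c. of_bool (c y = 0)) c =
      (\<Sum>w\<in>UNIV. p $ w) * (of_bool (c y = 0) * (1 - p $ y) ^ k)
        - p $ y * (of_bool (c y = 0) * (1 - p $ y) ^ k)"
    by (simp only: iid_expect.simps Suc sum_subtractf sum_distrib_right) simp
  then show ?case using p by (simp add: prob_vec_def algebra_simps)
qed simp

section \<open>Empirical deviation of a distribution on a finite set\<close>

text \<open>With \<open>x = u\<^sup>2 a\<close> this is \<open>0 \<le> (u - 1)\<^sup>2 (u + 2)\<close>; the bound is tight at \<open>x = a\<close>. It reduces
  \<open>E \<surd>N\<close> to the first two moments, and \<open>a = 1 + E N\<close> is used below because it makes
  \<open>E N\<^sup>2 \<le> a E N\<close>.\<close>

lemma sqrt_ge_quadratic: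
  assumes "0 < a" "0 \<le> (x::real)"
  shows "x * (3 - x / a) / (2 * sqrt a) \<le> sqrt x"
proof -
  define u where "u = sqrt x / sqrt a"
  have u: "0 \<le> u" "sqrt x = u * sqrt a" using assms by (auto simp: u_def)
  then have x: "x = u\<^sup>2 * a" using assms by (metis power_mult_distrib real_sqrt_pow2 less_imp_le)
  have "0 \<le> (u - 1)\<^sup>2 * (u + 2)" using u by simp
  then have "u * (u * (3 - u\<^sup>2)) \<le> u * 2"
    using u by (intro mult_left_mono) (auto simp: power2_eq_square algebra_simps)
  moreover have "x * (3 - x / a) / (2 * sqrt a) = (u * (u * (3 - u\<^sup>2)) / 2) * sqrt a"
  proof -
    have "x / sqrt a = u\<^sup>2 * sqrt a" "x / a = u\<^sup>2"
      using assms(1) real_div_sqrt[of a] unfolding x by (auto simp flip: times_divide_eq_right)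
    moreover have "x * (3 - x / a) / (2 * sqrt a) = (x / sqrt a) * (3 - x / a) / 2" by simp
    ultimately show ?thesis by (simp add: power2_eq_square)
  qed
  ultimately have "x * (3 - x / a) / (2 * sqrt a) = (u * (u * (3 - u\<^sup>2)) / 2) * sqrt a"
    and "u * (u * (3 - u\<^sup>2)) / 2 \<le> u" by auto
  then show ?thesis using assms unfolding u(2) by (metis mult_right_mono real_sqrt_ge_zero less_imp_le)
qed

text \<open>Expectations are taken in \<open>sqrt_ge_quadratic\<close> with
  \<open>a = 1 + q\<close>, where \<open>q\<close> is the mean of the count.\<close>

lemma iid_expect_sqrt_count_ge:
  assumes p: "prob_vec p"
  shows "k * p $ y / sqrt (1 + k * p $ y) \<le> iid_expect p k (\<lambda>c. sqrt (real (c y))) (\<lambda>_. 0)"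
proof -
  define q where "q = k * p $ y"
  define a where "a = 1 + q"
  have py: "0 \<le> p $ y" using p by (simp add: prob_vec_def)
  then have "0 \<le> q" by (simp add: q_def)
  then have q: "0 \<le> q" "0 < a" "0 \<le> p $ y" using py by (auto simp: a_def)
  have "iid_expect p k (\<lambda>c. (3 / (2 * sqrt a)) * real (c y) + (- 1 / (2 * a * sqrt a)) * (real (c y))\<^sup>2) (\<lambda>_. 0)
      \<le> iid_expect p k (\<lambda>c. sqrt (real (c y))) (\<lambda>_. 0)"
  proof (rule iid_expect_mono[OF p])
    fix c :: "'a \<Rightarrow> nat"
    show "(3 / (2 * sqrt a)) * real (c y) + (- 1 / (2 * a * sqrt a)) * (real (c y))\<^sup>2 \<le> sqrt (real (c y))"
      using sqrt_ge_quadratic[OF q(2), of "real (c y)"] q(2)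
      by (simp add: field_simps power2_eq_square)
  qed
  moreover have "iid_expect p k (\<lambda>c. (3 / (2 * sqrt a)) * real (c y) + (- 1 / (2 * a * sqrt a)) * (real (c y))\<^sup>2) (\<lambda>_. 0)
      = q * (3 - (1 - p $ y + q) / a) / (2 * sqrt a)"
    unfolding iid_expect_add iid_expect_cmult iid_expect_count[OF p] iid_expect_count_sq[OF p]
    using q by (simp add: q_def[symmetric] field_simps power2_eq_square)
  \<comment> \<open>Since \<open>1 - p $ y + q \<le> a\<close>, the factor
    \<open>3 - (1 - p $ y + q) / a\<close> is at least 2.\<close>
  moreover have "q * 2 / (2 * sqrt a) \<le> q * (3 - (1 - p $ y + q) / a) / (2 * sqrt a)"
    using q by (intro divide_right_mono mult_left_mono) (auto simp: a_def)
  ultimately show ?thesis by (simp add: a_def q_def)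
qed

text \<open>Two regimes for the mean \<open>q\<close>: an exact formula for
  \<open>q < 1 / 3\<close>, and the bound by the standard deviation, itself at most
  \<open>sqrt q\<close>, for larger \<open>q\<close>.\<close>

lemma iid_expect_abs_dev_le:
  assumes p: "prob_vec p"
  shows "iid_expect p k (\<lambda>c. \<bar>real (c y) - k * p $ y\<bar>) (\<lambda>_. 0)
    \<le> 2 * (k * p $ y / sqrt (1 + k * p $ y))"
proof -
  define q where "q = k * p $ y"
  have py: "0 \<le> p $ y" using p by (simp add: prob_vec_def)
  have py1: "p $ y \<le> 1" using p member_le_sum[of y UNIV "\<lambda>y. p $ y"] by (simp add: prob_vec_def)
  have q: "0 \<le> q" using py by (simp add: q_def)
  have "iid_expect p k (\<lambda>c. \<bar>real (c y) - q\<bar>) (\<lambda>_. 0) \<le> 2 * (q / sqrt (1 + q))"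
  proof (cases "q < 1 / 3")
    case True
    \<comment> \<open>For small \<open>q\<close> the variance bound \<open>\<surd>q\<close> is too weak, but the count falls below its mean only when
      it is 0.\<close>
    have "iid_expect p k (\<lambda>c. \<bar>real (c y) - q\<bar>) (\<lambda>_. 0)
        = iid_expect p k (\<lambda>c. (real (c y) + (- q)) + 2 * q * of_bool (c y = 0)) (\<lambda>_. 0)"
      using True q by (intro arg_cong2[of _ _ _ _ "iid_expect p k"] ext) auto
    also have "\<dots> = 2 * q * (1 - p $ y) ^ k"
      unfolding iid_expect_add iid_expect_cmult
      by (simp add: iid_expect_count[OF p] iid_expect_count_zero[OF p] iid_expect_const[OF p] q_def)
    also have "\<dots> \<le> 2 * q * (1 / sqrt (1 + q))"
    proof (intro mult_left_mono)
      have "(1 - p $ y) ^ k \<le> exp (- p $ y) ^ k"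
        using py1 exp_ge_add_one_self[of "- p $ y"] by (intro power_mono) auto
      also have "\<dots> = 1 / exp q"
        by (simp add: q_def exp_minus exp_of_nat_mult[symmetric] inverse_eq_divide power_divide)
      also have "\<dots> \<le> 1 / (1 + q)"
        using q exp_ge_add_one_self[of q] by (intro divide_left_mono) (auto simp del: exp_ge_add_one_self)
      also have "\<dots> \<le> 1 / sqrt (1 + q)"
        using q by (intro divide_left_mono) (auto simp: real_le_lsqrt power2_eq_square)
      finally show "(1 - p $ y) ^ k \<le> 1 / sqrt (1 + q)" .
    qed (use q in auto)
    finally show ?thesis by simp
  next
    case False
    define b where "b = sqrt q"
    have b: "0 < b" "b * b = q" using False by (auto simp: b_def)
    have "iid_expect p k (\<lambda>c. \<bar>real (c y) - q\<bar>) (\<lambda>_. 0)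
        \<le> iid_expect p k (\<lambda>c. (1 / (2 * b)) * (real (c y))\<^sup>2 + ((- q / b) * real (c y) + (q\<^sup>2 / (2 * b) + b / 2))) (\<lambda>_. 0)"
    proof (intro iid_expect_mono p)
      fix c :: "'a \<Rightarrow> nat"
      \<comment> \<open>The inequality \<open>2 * b * d \<le> d^2 + b^2\<close> replaces
        Cauchy-Schwarz, so that only the first two moments enter; \<open>b = sqrt q\<close> balances
        its two terms.\<close>
      have "0 \<le> (\<bar>real (c y) - q\<bar> - b)\<^sup>2" by simp
      then have "\<bar>real (c y) - q\<bar> * (2 * b) \<le> (real (c y) - q)\<^sup>2 + b\<^sup>2"
        by (simp add: power2_diff)
      then have "\<bar>real (c y) - q\<bar> \<le> ((real (c y) - q)\<^sup>2 + b\<^sup>2) / (2 * b)"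
        using b(1) by (simp add: pos_le_divide_eq)
      moreover have "((real (c y) - q)\<^sup>2 + b\<^sup>2) / (2 * b) =
          (1 / (2 * b)) * (real (c y))\<^sup>2 + ((- q / b) * real (c y) + (q\<^sup>2 / (2 * b) + b / 2))"
        using b(1) by (simp add: field_simps power2_eq_square)
      ultimately show "\<bar>real (c y) - q\<bar> \<le> (1 / (2 * b)) * (real (c y))\<^sup>2 + ((- q / b) * real (c y) + (q\<^sup>2 / (2 * b) + b / 2))"
        by simp
    qed
    also have "\<dots> = q * (1 - p $ y) / (2 * b) + b / 2"
      unfolding iid_expect_add iid_expect_cmult iid_expect_const[OF p] iid_expect_count[OF p] iid_expect_count_sq[OF p]
      using b(1) by (simp add: q_def[symmetric] field_simps power2_eq_square)
    also have "\<dots> \<le> q / (2 * b) + b / 2"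
      using b(1) q py by (auto intro!: divide_right_mono simp: mult_left_le)
    also have "\<dots> = b" using b by (simp add: field_simps)
    also have "b \<le> 2 * (b * b / sqrt (1 + q))"
    proof -
      \<comment> \<open>This is \<open>1 + q \<le> 4 * q\<close>, the origin of the threshold
        \<open>1 / 3\<close>.\<close>
      have "sqrt (1 + q) \<le> 2 * b"
        using False b by (intro real_le_lsqrt) (auto simp: power2_eq_square)
      then have "b * sqrt (1 + q) \<le> b * (2 * b)" using b by (intro mult_left_mono) auto
      then show ?thesis using q by (simp add: field_simps)
    qed
    finally show ?thesis using b by simp
  qed
  then show ?thesis by (simp add: q_def)
qed

section \<open>The excess deviation and its upper tail\<close>

text \<open>The unknown \<open>l1\<close> deviation from the mean counts, less an observable
  quantity whose mean is at least as large.\<close>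

definition excess_dev :: "real ^ 'x::finite \<Rightarrow> real \<Rightarrow> ('x \<Rightarrow> nat) \<Rightarrow> real" where
  "excess_dev p k c = (\<Sum>y\<in>UNIV. \<bar>real (c y) - k * p $ y\<bar> - 2 * sqrt (real (c y)))"

lemma iid_expect_excess_dev_nonpos:
  assumes p: "prob_vec p"
  shows "iid_expect p k (excess_dev p k) (\<lambda>_. 0) \<le> 0"
proof -
  have "iid_expect p k (excess_dev p k) (\<lambda>_. 0) =
     (\<Sum>y\<in>UNIV. iid_expect p k (\<lambda>c. \<bar>real (c y) - k * p $ y\<bar> + (- 2) * sqrt (real (c y))) (\<lambda>_. 0))"
    unfolding excess_dev_def by (subst iid_expect_sum[OF p]) auto
  also have "\<dots> \<le> 0"
    unfolding iid_expect_add iid_expect_cmult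
    using iid_expect_abs_dev_le[OF p, of k] iid_expect_sqrt_count_ge[OF p, of k]
    by (intro sum_nonpos) (smt (verit))
  finally show ?thesis .
qed

lemma sqrt_Suc_le: "sqrt (real (Suc n)) \<le> sqrt (real n) + 1"
  by (rule real_le_lsqrt) (auto simp: power2_eq_square algebra_simps)

text \<open>Both histograms are compared with \<open>c\<close>. One more draw raises its summand by
  at most 1, as the root only grows; it lowers a summand by at most 3, 1 from the absolute value and
  2 from the root.\<close>

lemma excess_dev_diff_le:
  "excess_dev p k (c(y := Suc (c y))) - excess_dev p k (c(z := Suc (c z))) \<le> 4"
proof -
  define e where "e n w = \<bar>real n - k * p $ w\<bar> - 2 * sqrt (real n)" for n w
  have up: "e (Suc n) w \<le> e n w + 1" "e n w \<le> e (Suc n) w + 3" for n w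
    using sqrt_Suc_le[of n] unfolding e_def by (smt (verit) of_nat_Suc real_sqrt_le_mono)+
  have upd: "excess_dev p k (c(v := Suc (c v))) = excess_dev p k c + (e (Suc (c v)) v - e (c v) v)" for v
  proof -
    have "excess_dev p k (c(v := Suc (c v))) - excess_dev p k c =
        (\<Sum>w\<in>UNIV. if w = v then e (Suc (c v)) v - e (c v) v else 0)"
      unfolding excess_dev_def e_def[symmetric] sum_subtractf[symmetric]
      by (intro sum.cong) auto
    then show ?thesis by simp
  qed
  show ?thesis using up(1)[of "c y" y] up(2)[of "c z" z] unfolding upd by simp
qed

text \<open>Bounded differences with \<open>C = 4\<close> give the exponent
  \<open>9 / 4 * L\<close>, more than the claim. The threshold is twice the logarithmic term in the
  numerator of \<open>W_hat\<close>.\<close>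

lemma iid_excess_dev_tail:
  assumes p: "prob_vec p" and "0 < k" "0 \<le> L"
  shows "iid_expect p k (\<lambda>c. of_bool (3 * sqrt 2 * sqrt k * sqrt L < excess_dev p k c)) (\<lambda>_. 0) \<le> exp (- L)"
proof -
  have "iid_expect p k (\<lambda>c. of_bool (3 * sqrt 2 * sqrt k * sqrt L < excess_dev p k c)) (\<lambda>_. 0)
      \<le> exp (- 2 * (3 * sqrt 2 * sqrt k * sqrt L)\<^sup>2 / (real k * 4\<^sup>2))"
    using assms by (intro iid_expect_tail_le excess_dev_diff_le iid_expect_excess_dev_nonpos) auto
  also have "\<dots> \<le> exp (- L)"
    using assms by (simp add: power_mult_distrib)
  finally show ?thesis .
qed

section \<open>Markov chains and their skipped trajectories\<close>

text \<open>Stands in for measurability with respect to the first \<open>t\<close> states. Over a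
  finite space such functionals reduce to finitely many paths, and later times, about which nothing
  may be known, do not enter.\<close>

definition depends_upto :: "nat \<Rightarrow> ((nat \<Rightarrow> 'x) \<Rightarrow> 'b) \<Rightarrow> bool" where
  "depends_upto t H \<longleftrightarrow> (\<forall>y y'. (\<forall>i\<in>{1..t}. y i = y' i) \<longrightarrow> H y = H y')"

lemma depends_uptoD: "depends_upto t H \<Longrightarrow> (\<And>i. 1 \<le> i \<Longrightarrow> i \<le> t \<Longrightarrow> y i = y' i) \<Longrightarrow> H y = H y'"
  unfolding depends_upto_def by (meson atLeastAtMost_iff)

lemma depends_upto_expand:
  fixes H :: "(nat \<Rightarrow> 'x::finite) \<Rightarrow> real"
  assumes "depends_upto t H"
  shows "H y = (\<Sum>f\<in>PiE {1..t} (\<lambda>_. UNIV). H f * of_bool (\<forall>i\<in>{1..t}. y i = f i))"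
proof -
  have "of_bool (\<forall>i\<in>{1..t}. y i = f i) = (if f = restrict y {1..t} then 1 else (0::real))"
    if "f \<in> PiE {1..t} (\<lambda>_. UNIV)" for f
    using that by (force simp: fun_eq_iff PiE_def extensional_def)
  then have "(\<Sum>f\<in>PiE {1..t} (\<lambda>_. UNIV). H f * of_bool (\<forall>i\<in>{1..t}. y i = f i)) =
      (\<Sum>f\<in>PiE {1..t} (\<lambda>_. UNIV). if f = restrict y {1..t} then H f else 0)"
    by (intro sum.cong) auto
  also have "\<dots> = H (restrict y {1..t})"
    by (simp add: finite_PiE sum.delta)
  also have "\<dots> = H y" by (rule depends_uptoD[OF assms]) auto
  finally show ?thesis by simp
qed

text \<open>Keeps the skipped times within \<open>{1..m}\<close>, where the trajectory is
  specified.\<close>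

lemma skip_index_le: "1 \<le> m \<Longrightarrow> t \<le> skip_len s m \<Longrightarrow> 1 + (t - 1) * s \<le> m"
proof -
  assume m: "1 \<le> m" and t: "t \<le> skip_len s m"
  have "(t - 1) * s \<le> (m - 1) div s * s" using t by (intro mult_right_mono) (auto simp: skip_len_def)
  also have "\<dots> \<le> m - 1" by simp
  finally show ?thesis using m by linarith
qed

context prob_space begin

text \<open>The event is a finite union of cylinders, one for each extensional path satisfying
  \<open>\<Phi>\<close>.\<close>

lemma sets_depends_upto:
  fixes X :: "nat \<Rightarrow> 'a \<Rightarrow> 'x::finite"
  assumes "\<And>i. 1 \<le> i \<Longrightarrow> i \<le> t \<Longrightarrow> X i \<in> measurable M (count_space UNIV)" "depends_upto t \<Phi>"
  shows "{\<omega> \<in> space M. \<Phi> (\<lambda>i. X i \<omega>)} \<in> events"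
proof -
  have "{\<omega> \<in> space M. \<Phi> (\<lambda>i. X i \<omega>)} =
      (\<Union>f\<in>{f \<in> PiE {1..t} (\<lambda>_. UNIV). \<Phi> f}. {\<omega> \<in> space M. \<forall>i\<in>{1..t}. X i \<omega> = f i})"
  proof (intro equalityI subsetI)
    fix \<omega> assume *: "\<omega> \<in> {\<omega> \<in> space M. \<Phi> (\<lambda>i. X i \<omega>)}"
    have "\<Phi> (restrict (\<lambda>i. X i \<omega>) {1..t}) = \<Phi> (\<lambda>i. X i \<omega>)"
      by (rule depends_uptoD[OF assms(2)]) auto
    with * show "\<omega> \<in> (\<Union>f\<in>{f \<in> PiE {1..t} (\<lambda>_. UNIV). \<Phi> f}. {\<omega> \<in> space M. \<forall>i\<in>{1..t}. X i \<omega> = f i})"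
      by (intro UN_I[of "restrict (\<lambda>i. X i \<omega>) {1..t}"]) auto
  next
    fix \<omega> assume "\<omega> \<in> (\<Union>f\<in>{f \<in> PiE {1..t} (\<lambda>_. UNIV). \<Phi> f}. {\<omega> \<in> space M. \<forall>i\<in>{1..t}. X i \<omega> = f i})"
    then obtain f where f: "\<Phi> f" "\<omega> \<in> space M" "\<forall>i\<in>{1..t}. X i \<omega> = f i" by auto
    then have "\<Phi> (\<lambda>i. X i \<omega>) = \<Phi> f" by (intro depends_uptoD[OF assms(2)]) auto
    with f show "\<omega> \<in> {\<omega> \<in> space M. \<Phi> (\<lambda>i. X i \<omega>)}" by simp
  qed
  also have "\<dots> \<in> events"
  proof (intro sets.finite_UN ballI)
    fix f :: "nat \<Rightarrow> 'x"
    have "{\<omega> \<in> space M. X i \<omega> = f i} \<in> events" if "i \<in> {1..t}" for i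
      using measurable_sets[OF assms(1), of i "{f i}"] that by (simp add: vimage_def Int_def conj_commute)
    then show "{\<omega> \<in> space M. \<forall>i\<in>{1..t}. X i \<omega> = f i} \<in> events"
      by (intro sets.sets_Collect_finite_All) auto
  qed (simp add: finite_PiE)
  finally show ?thesis .
qed

lemma sets_cylinder:
  fixes X :: "nat \<Rightarrow> 'a \<Rightarrow> 'x::finite"
  assumes "\<And>i. 1 \<le> i \<Longrightarrow> i \<le> t \<Longrightarrow> X i \<in> measurable M (count_space UNIV)"
  shows "{\<omega> \<in> space M. \<forall>i\<in>{1..t}. X i \<omega> = f i} \<in> events"
  by (rule sets_depends_upto[OF assms, where \<Phi> = "\<lambda>y. \<forall>i\<in>{1..t}. y i = f i"])
    (auto simp: depends_upto_def)

text \<open>The functional is a finite combination of cylinder indicators, which turns expectations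
  into sums over paths.\<close>

lemma
  fixes X :: "nat \<Rightarrow> 'a \<Rightarrow> 'x::finite" and H :: "(nat \<Rightarrow> 'x) \<Rightarrow> real"
  assumes X: "\<And>i. 1 \<le> i \<Longrightarrow> i \<le> t \<Longrightarrow> X i \<in> measurable M (count_space UNIV)" and H: "depends_upto t H"
  shows integrable_depends_upto: "integrable M (\<lambda>\<omega>. H (\<lambda>i. X i \<omega>))"
    and expectation_depends_upto: "expectation (\<lambda>\<omega>. H (\<lambda>i. X i \<omega>)) =
      (\<Sum>f\<in>PiE {1..t} (\<lambda>_. UNIV). H f * prob {\<omega> \<in> space M. \<forall>i\<in>{1..t}. X i \<omega> = f i})"
proof -
  let ?C = "\<lambda>f. {\<omega> \<in> space M. \<forall>i\<in>{1..t}. X i \<omega> = f i}"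
  have C: "?C f \<in> events" for f by (rule sets_cylinder[OF X])
  have int: "integrable M (indicator (?C f) :: _ \<Rightarrow> real)" for f
    using C emeasure_finite by (intro integrable_real_indicator) (auto simp: less_top[symmetric])
  have eq: "H (\<lambda>i. X i \<omega>) = (\<Sum>f\<in>PiE {1..t} (\<lambda>_. UNIV). H f * indicator (?C f) \<omega>)" if "\<omega> \<in> space M" for \<omega>
    using that by (subst depends_upto_expand[OF H]) (auto simp: indicator_def intro!: sum.cong)
  have "integrable M (\<lambda>\<omega>. \<Sum>f\<in>PiE {1..t} (\<lambda>_. UNIV). H f * indicator (?C f) \<omega>)"
    by (intro Bochner_Integration.integrable_sum integrable_mult_right int)
  then show "integrable M (\<lambda>\<omega>. H (\<lambda>i. X i \<omega>))"
    by (subst Bochner_Integration.integrable_cong[OF refl eq]) auto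
  have "expectation (\<lambda>\<omega>. H (\<lambda>i. X i \<omega>)) =
      expectation (\<lambda>\<omega>. \<Sum>f\<in>PiE {1..t} (\<lambda>_. UNIV). H f * indicator (?C f) \<omega>)"
    by (intro Bochner_Integration.integral_cong[OF refl eq])
  also have "\<dots> = (\<Sum>f\<in>PiE {1..t} (\<lambda>_. UNIV). H f * prob (?C f))"
    using C by (subst Bochner_Integration.integral_sum) (auto intro!: integrable_mult_right int simp: Int_absorb2 simp del: One_nat_def)
  finally show "expectation (\<lambda>\<omega>. H (\<lambda>i. X i \<omega>)) = \<dots>" .
qed

text \<open>The Markov property in integrated form, which avoids conditioning on null events. The
  functional \<open>h\<close> may depend on the whole past, so this form passes to skipped trajectories.\<close>

definition markov_process :: "nat \<Rightarrow> real ^ 'x ^ 'x::finite \<Rightarrow> (nat \<Rightarrow> 'a \<Rightarrow> 'x) \<Rightarrow> bool" where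
  "markov_process n Q Y \<longleftrightarrow>
     (\<forall>t\<in>{1..n}. Y t \<in> measurable M (count_space UNIV)) \<and>
     (\<forall>t\<in>{1..<n}. \<forall>h :: _ \<Rightarrow> _ \<Rightarrow> real. (\<forall>z. depends_upto t (\<lambda>y. h y z)) \<longrightarrow>
       expectation (\<lambda>\<omega>. h (\<lambda>i. Y i \<omega>) (Y (Suc t) \<omega>)) =
       expectation (\<lambda>\<omega>. \<Sum>z\<in>UNIV. Q $ Y t \<omega> $ z * h (\<lambda>i. Y i \<omega>) z))"

text \<open>Downward induction from the full length \<open>m\<close>, where this is the definition:
  summing over the last state removes one factor because the rows of \<open>P\<close> sum to
  1.\<close>

lemma markov_trajectory_prob:
  assumes P: "row_stochastic P" and traj: "markov_trajectory M m \<mu> P X" and t: "1 \<le> t" "t \<le> m"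
  shows "prob {\<omega> \<in> space M. \<forall>i\<in>{1..t}. X i \<omega> = x i} = \<mu> $ x 1 * (\<Prod>i = 1..<t. P $ x i $ x (Suc i))"
  using t(2,1)
proof (induction arbitrary: x rule: inc_induct)
  case base
  then show ?case using traj by (simp add: markov_trajectory_def)
next
  case (step n)
  have X: "X i \<in> measurable M (count_space UNIV)" if "1 \<le> i" "i \<le> Suc n" for i
    using traj that step by (auto simp: markov_trajectory_def)
  let ?A = "\<lambda>z. {\<omega> \<in> space M. \<forall>i\<in>{1..Suc n}. X i \<omega> = (x(Suc n := z)) i}"
  have "{\<omega> \<in> space M. \<forall>i\<in>{1..n}. X i \<omega> = x i} = (\<Union>z\<in>UNIV. ?A z)"
    by (auto simp: le_Suc_eq)
  also have "prob \<dots> = (\<Sum>z\<in>UNIV. prob (?A z))"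
  proof (rule finite_measure_finite_Union)
    show "?A ` UNIV \<subseteq> events" 
      by (rule image_subsetI, rule sets_cylinder, rule X) auto
    have "z = z'" if "\<omega> \<in> ?A z" "\<omega> \<in> ?A z'" for z z' \<omega>
    proof -
      have "X (Suc n) \<omega> = z" "X (Suc n) \<omega> = z'"
        using that by (auto dest: bspec[of _ _ "Suc n"])
      then show ?thesis by simp
    qed
    then show "disjoint_family_on ?A UNIV"
      unfolding disjoint_family_on_def by blast
  qed simp
  also have "\<dots> = (\<Sum>z\<in>UNIV. \<mu> $ x 1 * (\<Prod>i = 1..<n. P $ x i $ x (Suc i)) * P $ x n $ z)"
  proof (intro sum.cong refl)
    fix z
    have "(\<Prod>i = 1..<Suc n. P $ (x(Suc n := z)) i $ (x(Suc n := z)) (Suc i)) =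
        (\<Prod>i = 1..<n. P $ x i $ x (Suc i)) * P $ x n $ z"
      using step.prems by (simp add: prod.atLeastLessThan_Suc)
    then show "prob (?A z) = \<mu> $ x 1 * (\<Prod>i = 1..<n. P $ x i $ x (Suc i)) * P $ x n $ z"
      using step.IH[of "x(Suc n := z)"] step.prems by simp
  qed
  also have "\<dots> = \<mu> $ x 1 * (\<Prod>i = 1..<n. P $ x i $ x (Suc i))"
    using P by (simp add: row_stochastic_def prob_vec_def flip: sum_distrib_left)
  finally show ?case .
qed

lemma sum_PiE_Suc:
  fixes g :: "(nat \<Rightarrow> 'x::finite) \<Rightarrow> real"
  shows "(\<Sum>f\<in>PiE {1..Suc t} (\<lambda>_. UNIV). g f) = (\<Sum>f\<in>PiE {1..t} (\<lambda>_. UNIV). \<Sum>z\<in>UNIV. g (f(Suc t := z)))"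
proof -
  let ?E = "PiE {1..t} (\<lambda>_. UNIV :: 'x set)" and ?u = "\<lambda>(z, f). f(Suc t := z)"
  have "PiE {1..Suc t} (\<lambda>_. UNIV) = ?u ` (UNIV \<times> ?E)"
    by (simp add: atLeastAtMostSuc_conv PiE_insert_eq)
  moreover have "inj_on ?u (UNIV \<times> ?E)"
    by (rule inj_combinator) simp
  ultimately have "(\<Sum>f\<in>PiE {1..Suc t} (\<lambda>_. UNIV). g f) = (\<Sum>x\<in>UNIV \<times> ?E. g (?u x))"
    by (simp only: sum.reindex comp_def)
  also have "\<dots> = (\<Sum>z\<in>UNIV. \<Sum>f\<in>?E. g (f(Suc t := z)))"
    unfolding sum.cartesian_product by (intro sum.cong) auto
  also have "\<dots> = (\<Sum>f\<in>?E. \<Sum>z\<in>UNIV. g (f(Suc t := z)))"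
    by (rule sum.swap)
  finally show ?thesis .
qed

text \<open>Both sides are sums over paths. The weight of a path extended by \<open>z\<close> is
  \<open>w f * P $ f t $ z\<close>, and \<open>h\<close> does not see the appended state.\<close>

lemma markov_trajectory_step:
  fixes P :: "real ^ 'x ^ 'x::finite" and h :: "(nat \<Rightarrow> 'x) \<Rightarrow> 'x \<Rightarrow> real"
  assumes P: "row_stochastic P" and traj: "markov_trajectory M m \<mu> P X" and t: "1 \<le> t" "t < m"
    and h: "\<And>z. depends_upto t (\<lambda>y. h y z)"
  shows "expectation (\<lambda>\<omega>. h (\<lambda>i. X i \<omega>) (X (Suc t) \<omega>)) =
    expectation (\<lambda>\<omega>. \<Sum>z\<in>UNIV. P $ X t \<omega> $ z * h (\<lambda>i. X i \<omega>) z)"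
proof -
  have X: "X i \<in> measurable M (count_space UNIV)" if "1 \<le> i" "i \<le> Suc t" for i
    using traj that t by (auto simp: markov_trajectory_def)
  have d1: "depends_upto (Suc t) (\<lambda>y. h y (y (Suc t)))"
    unfolding depends_upto_def
  proof safe
    fix y y' :: "nat \<Rightarrow> 'x" assume *: "\<forall>i\<in>{1..Suc t}. y i = y' i"
    then have "h y z = h y' z" for z by (intro depends_uptoD[OF h]) auto
    with * show "h y (y (Suc t)) = h y' (y' (Suc t))" by simp
  qed
  have d2: "depends_upto t (\<lambda>y. \<Sum>z\<in>UNIV. P $ y t $ z * h y z)"
    unfolding depends_upto_def
  proof safe
    fix y y' :: "nat \<Rightarrow> 'x" assume *: "\<forall>i\<in>{1..t}. y i = y' i"
    then have "h y z = h y' z" for z by (intro depends_uptoD[OF h]) auto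
    with * t show "(\<Sum>z\<in>UNIV. P $ y t $ z * h y z) = (\<Sum>z\<in>UNIV. P $ y' t $ z * h y' z)" by simp
  qed
  define w where "w f = \<mu> $ f 1 * (\<Prod>i = 1..<t. P $ f i $ f (Suc i))" for f
  have "expectation (\<lambda>\<omega>. h (\<lambda>i. X i \<omega>) (X (Suc t) \<omega>)) =
      (\<Sum>f\<in>PiE {1..Suc t} (\<lambda>_. UNIV). h f (f (Suc t)) * prob {\<omega> \<in> space M. \<forall>i\<in>{1..Suc t}. X i \<omega> = f i})"
    using X by (intro expectation_depends_upto[OF _ d1])
  also have "\<dots> = (\<Sum>f\<in>PiE {1..Suc t} (\<lambda>_. UNIV). h f (f (Suc t)) * (\<mu> $ f 1 * (\<Prod>i = 1..<Suc t. P $ f i $ f (Suc i))))"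
    using t by (simp only: markov_trajectory_prob[OF P traj])
  also have "\<dots> = (\<Sum>f\<in>PiE {1..t} (\<lambda>_. UNIV). \<Sum>z\<in>UNIV. h f z * (w f * P $ f t $ z))"
    unfolding sum_PiE_Suc
  proof (intro sum.cong refl)
    fix f z
    have "h (f(Suc t := z)) z = h f z" by (rule depends_uptoD[OF h]) auto
    then show "h (f(Suc t := z)) ((f(Suc t := z)) (Suc t)) * (\<mu> $ (f(Suc t := z)) 1 *
        (\<Prod>i = 1..<Suc t. P $ (f(Suc t := z)) i $ (f(Suc t := z)) (Suc i))) = h f z * (w f * P $ f t $ z)"
      using t by (simp add: w_def prod.atLeastLessThan_Suc)
  qed
  also have "\<dots> = (\<Sum>f\<in>PiE {1..t} (\<lambda>_. UNIV). (\<Sum>z\<in>UNIV. P $ f t $ z * h f z) * w f)"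
    by (simp add: sum_distrib_left sum_distrib_right mult_ac)
  also have "\<dots> = (\<Sum>f\<in>PiE {1..t} (\<lambda>_. UNIV). (\<Sum>z\<in>UNIV. P $ f t $ z * h f z) *
      prob {\<omega> \<in> space M. \<forall>i\<in>{1..t}. X i \<omega> = f i})"
    using t by (simp only: markov_trajectory_prob[OF P traj] w_def)
  also have "\<dots> = expectation (\<lambda>\<omega>. \<Sum>z\<in>UNIV. P $ X t \<omega> $ z * h (\<lambda>i. X i \<omega>) z)"
    using X by (intro expectation_depends_upto[OF _ d2, symmetric]) auto
  finally show ?thesis .
qed

text \<open>The last step is taken at time \<open>t + r\<close>, with \<open>h\<close> regarded as a
  functional of that longer past. The induction hypothesis is then applied to the one-step average
  of \<open>h\<close>, hence the induction over arbitrary \<open>h\<close>.\<close>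

lemma markov_trajectory_multistep:
  fixes P :: "real ^ 'x ^ 'x::finite" and h :: "(nat \<Rightarrow> 'x) \<Rightarrow> 'x \<Rightarrow> real"
  assumes P: "row_stochastic P" and traj: "markov_trajectory M m \<mu> P X" and t: "1 \<le> t"
    and h: "\<And>z. depends_upto t (\<lambda>y. h y z)"
  shows "t + r \<le> m \<Longrightarrow> expectation (\<lambda>\<omega>. h (\<lambda>i. X i \<omega>) (X (t + r) \<omega>)) =
    expectation (\<lambda>\<omega>. \<Sum>z\<in>UNIV. mat_pow P r $ X t \<omega> $ z * h (\<lambda>i. X i \<omega>) z)"
  using h
proof (induction r arbitrary: h)
  case 0
  have "(\<Sum>z\<in>UNIV. mat 1 $ u $ z * g z) = g u" for u :: 'x and g :: "'x \<Rightarrow> real"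
  proof -
    have "(\<Sum>z\<in>UNIV. mat 1 $ u $ z * g z) = (\<Sum>z\<in>UNIV. if z = u then g z else 0)"
      by (intro sum.cong) (auto simp: mat_def)
    then show ?thesis by simp
  qed
  then show ?case by simp
next
  case (Suc r)
  have d: "depends_upto t' (\<lambda>y. h y z)" if "t \<le> t'" for z t'
    unfolding depends_upto_def
  proof safe
    fix y y' :: "nat \<Rightarrow> 'x" assume "\<forall>i\<in>{1..t'}. y i = y' i"
    with that show "h y z = h y' z" by (intro depends_uptoD[OF Suc.prems(2)]) auto
  qed
  have "expectation (\<lambda>\<omega>. h (\<lambda>i. X i \<omega>) (X (t + Suc r) \<omega>)) =
      expectation (\<lambda>\<omega>. \<Sum>z\<in>UNIV. P $ X (t + r) \<omega> $ z * h (\<lambda>i. X i \<omega>) z)"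
    unfolding add_Suc_right using Suc.prems(1) t
    by (intro markov_trajectory_step[OF P traj _ _ d]) simp_all
  also have "\<dots> = expectation (\<lambda>\<omega>. \<Sum>u\<in>UNIV. mat_pow P r $ X t \<omega> $ u *
      (\<Sum>z\<in>UNIV. P $ u $ z * h (\<lambda>i. X i \<omega>) z))"
  proof (rule Suc.IH[of "\<lambda>y u. \<Sum>z\<in>UNIV. P $ u $ z * h y z"])
    show "depends_upto t (\<lambda>y. \<Sum>z\<in>UNIV. P $ u $ z * h y z)" for u
      unfolding depends_upto_def
    proof safe
      fix y y' :: "nat \<Rightarrow> 'x" assume "\<forall>i\<in>{1..t}. y i = y' i"
      then have "h y z = h y' z" for z by (intro depends_uptoD[OF Suc.prems(2)]) auto
      then show "(\<Sum>z\<in>UNIV. P $ u $ z * h y z) = (\<Sum>z\<in>UNIV. P $ u $ z * h y' z)" by simp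
    qed
  qed (use Suc.prems(1) in simp)
  also have "\<dots> = expectation (\<lambda>\<omega>. \<Sum>z\<in>UNIV. mat_pow P (Suc r) $ X t \<omega> $ z * h (\<lambda>i. X i \<omega>) z)"
  proof -
    have "(\<Sum>u\<in>UNIV. mat_pow P r $ v $ u * (\<Sum>z\<in>UNIV. P $ u $ z * g z)) =
        (\<Sum>z\<in>UNIV. mat_pow P (Suc r) $ v $ z * g z)" for v and g :: "'x \<Rightarrow> real"
      unfolding mat_pow.simps matrix_matrix_mult_def
      by (simp add: sum_distrib_left sum_distrib_right mult.assoc) (rule sum.swap)
    then show ?thesis by simp
  qed
  finally show ?case .
qed

text \<open>The first \<open>t\<close> skipped states are determined by the original ones up to time
  \<open>1 + (t - 1) * s\<close>, from which the multistep property is applied with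
  \<open>r = s\<close>.\<close>

lemma markov_process_skip:
  fixes P :: "real ^ 'x ^ 'x::finite"
  assumes P: "row_stochastic P" and traj: "markov_trajectory M m \<mu> P X" and m: "1 \<le> m" and s: "1 \<le> s"
  shows "markov_process (skip_len s m) (mat_pow P s) (skip s X)"
  unfolding markov_process_def
proof (intro conjI ballI allI impI)
  have le: "1 + (t - 1) * s \<le> m" if "t \<in> {1..skip_len s m}" for t
    using skip_index_le[OF m] that by simp
  fix t
  {
    assume "t \<in> {1..skip_len s m}"
    with le[OF this] show "skip s X t \<in> measurable M (count_space UNIV)"
      using traj by (auto simp: skip_def markov_trajectory_def)
  }
  fix h :: "(nat \<Rightarrow> 'x) \<Rightarrow> 'x \<Rightarrow> real"
  assume t: "t \<in> {1..<skip_len s m}" and h: "\<forall>z. depends_upto t (\<lambda>y. h y z)"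
  let ?t = "1 + (t - 1) * s"
  \<comment> \<open>Because \<open>t\<close> is positive, the truncated subtraction is harmless and
    consecutive skipped times differ by exactly \<open>s\<close>.\<close>
  have Suc_t: "1 + (Suc t - 1) * s = ?t + s"
    using t by (cases t) auto
  have d: "depends_upto ?t (\<lambda>y. h (skip s y) z)" for z
    unfolding depends_upto_def
  proof safe
    fix y y' :: "nat \<Rightarrow> 'x" assume *: "\<forall>i\<in>{1..?t}. y i = y' i"
    show "h (skip s y) z = h (skip s y') z"
    proof (rule depends_uptoD[OF h[rule_format]])
      fix i assume i: "1 \<le> i" "i \<le> t"
      then have "(i - 1) * s \<le> (t - 1) * s" by (intro mult_right_mono) auto
      then show "skip s y i = skip s y' i" using * by (auto simp: skip_def)
    qed
  qed
  have "expectation (\<lambda>\<omega>. h (skip s (\<lambda>i. X i \<omega>)) (X (?t + s) \<omega>)) =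
    expectation (\<lambda>\<omega>. \<Sum>z\<in>UNIV. mat_pow P s $ X ?t \<omega> $ z * h (skip s (\<lambda>i. X i \<omega>)) z)"
    using le[of "Suc t"] t Suc_t by (intro markov_trajectory_multistep[OF P traj _ d]) auto
  then show "expectation (\<lambda>\<omega>. h (\<lambda>i. skip s X i \<omega>) (skip s X (Suc t) \<omega>)) =
      expectation (\<lambda>\<omega>. \<Sum>z\<in>UNIV. mat_pow P s $ skip s X t \<omega> $ z * h (\<lambda>i. skip s X i \<omega>) z)"
    unfolding skip_def Suc_t .
qed

end

section \<open>Transition counts along a Markov chain\<close>

lemma visits_Suc: "1 \<le> t \<Longrightarrow> visits (Suc t) y x = visits t y x + of_bool (y t = x)"
proof -
  assume "1 \<le> t"
  then have "{i \<in> {1..<Suc t}. y i = x} = (if y t = x then insert t else id) {i \<in> {1..<t}. y i = x}"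
    by (auto simp: less_Suc_eq)
  then show ?thesis by (simp add: visits_def)
qed

lemma transitions_Suc:
  "1 \<le> t \<Longrightarrow> transitions (Suc t) y x z = transitions t y x z + of_bool (y t = x \<and> y (Suc t) = z)"
proof -
  assume "1 \<le> t"
  then have "{i \<in> {1..<Suc t}. y i = x \<and> y (i + 1) = z} =
      (if y t = x \<and> y (Suc t) = z then insert t else id) {i \<in> {1..<t}. y i = x \<and> y (i + 1) = z}"
    by (auto simp: less_Suc_eq)
  then show ?thesis by (simp add: transitions_def)
qed

lemma visits_1 [simp]: "visits (Suc 0) y x = 0"
  by (simp add: visits_def)

lemma transitions_1 [simp]: "transitions (Suc 0) y x z = 0"
  by (simp add: transitions_def)

lemma depends_upto_visits: "depends_upto t (\<lambda>y. visits t y x)"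
  unfolding depends_upto_def visits_def by (auto intro!: arg_cong[where f = card])

lemma depends_upto_transitions: "depends_upto t (\<lambda>y. transitions t y x)"
  unfolding depends_upto_def transitions_def by (auto simp: fun_eq_iff intro!: arg_cong[where f = card])

lemma visits_less: "1 \<le> n \<Longrightarrow> visits n y x < n"
proof -
  assume "1 \<le> n"
  moreover have "visits n y x \<le> card {1..<n}"
    unfolding visits_def by (rule card_mono) auto
  ultimately show ?thesis by simp
qed

text \<open>The final time is not counted as a visit, so each counted visit has exactly one
  successor inside the sequence.\<close>

lemma sum_transitions: "(\<Sum>z\<in>UNIV. transitions n y x z) = visits n y (x :: 'x::finite)"
proof (induction n)
  case 0
  show ?case by (simp add: transitions_def visits_def)
next
  case (Suc n)
  show ?case
  proof (cases "1 \<le> n")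
    case True
    have "of_bool (y n = x \<and> y (Suc n) = z) = (if z = y (Suc n) then of_bool (y n = x) else 0 :: nat)" for z
      by auto
    with True Suc show ?thesis by (simp add: transitions_Suc visits_Suc sum.distrib)
  next
    case False
    then have "n = 0" by simp
    then show ?thesis by simp
  qed
qed

context prob_space begin

text \<open>The first \<open>k\<close> successors of \<open>x\<close> behave like an i.i.d. sample from \<open>Q $ x\<close>: completing those
  seen so far by fresh samples yields a supermartingale, which drops to zero after the \<open>k\<close>-th visit.\<close>

lemma markov_process_successors:
  fixes Q :: "real ^ 'x ^ 'x::finite"
  assumes Y: "markov_process n Q Y" and Q: "row_stochastic Q" and n: "1 \<le> n" and g: "\<And>c. 0 \<le> g c"
  shows "expectation (\<lambda>\<omega>. of_bool (visits n (\<lambda>i. Y i \<omega>) x = k) * g (transitions n (\<lambda>i. Y i \<omega>) x))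
    \<le> iid_expect (Q $ x) k g (\<lambda>_. 0)"
proof -
  have p: "prob_vec (Q $ x)" for x using Q by (simp add: row_stochastic_def)
  have meas: "Y i \<in> measurable M (count_space UNIV)" if "1 \<le> i" "i \<le> n" for i
    using Y that by (auto simp: markov_process_def)
  define V where "V t y = (if visits t y x \<le> k
    then iid_expect (Q $ x) (k - visits t y x) g (transitions t y x) else 0)" for t y
  have V0: "0 \<le> V t y" for t y
    by (auto simp: V_def intro: iid_expect_nonneg[OF p g])
  have dV: "depends_upto t (V t)" for t
    using depends_upto_visits[of t x] depends_upto_transitions[of t x]
    unfolding depends_upto_def V_def by metis
  have "expectation (\<lambda>\<omega>. V t (\<lambda>i. Y i \<omega>)) \<le> iid_expect (Q $ x) k g (\<lambda>_. 0)" if "1 \<le> t" "t \<le> n" for t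
    using that
  proof (induction t rule: nat_induct_at_least)
    case base
    have "transitions (Suc 0) y x = (\<lambda>_. 0)" for y by auto
    then show ?case by (simp add: V_def prob_space)
  next
    case (Suc t)
    \<comment> \<open>The value of \<open>V (Suc t)\<close> if the next state is \<open>z\<close>. A
      visit at time \<open>t\<close> enters \<open>visits\<close> only at \<open>Suc t\<close>,
      together with its transition, so a visit after \<open>k\<close> earlier ones yields 0.\<close>
    define h where "h y z = (if y t = x then
      if visits t y x < k
        then iid_expect (Q $ x) (k - Suc (visits t y x)) g ((transitions t y x)(z := Suc (transitions t y x z)))
        else 0
      else V t y)" for y z
    have Vh: "V (Suc t) y = h y (y (Suc t))" for y
    proof -
      have "transitions (Suc t) y x = (if y t = x
          then (transitions t y x)(y (Suc t) := Suc (transitions t y x (y (Suc t))))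
          else transitions t y x)"
        using Suc.hyps by (auto simp: transitions_Suc fun_eq_iff)
      then show ?thesis
        using Suc.hyps by (auto simp: V_def h_def visits_Suc)
    qed
    have dh: "depends_upto t (\<lambda>y. h y z)" for z
      unfolding depends_upto_def
    proof safe
      fix y y' :: "nat \<Rightarrow> 'x" assume *: "\<forall>i\<in>{1..t}. y i = y' i"
      then have "visits t y x = visits t y' x" "transitions t y x = transitions t y' x" "V t y = V t y'"
        using depends_upto_visits[of t x] depends_upto_transitions[of t x] dV[of t]
        unfolding depends_upto_def by blast+
      with * Suc.hyps show "h y z = h y' z" unfolding h_def by simp
    qed
    \<comment> \<open>Equality holds at a visit with samples left, by the recursion of
      \<open>iid_expect\<close>, and away from \<open>x\<close>, as rows sum to 1. A visit after the
      \<open>k\<close>-th can only lose value.\<close>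
    have le: "(\<Sum>z\<in>UNIV. Q $ y t $ z * h y z) \<le> V t y" for y
    proof (cases "y t = x")
      case True
      show ?thesis
      proof (cases "visits t y x < k")
        case True
        then obtain j where j: "k - visits t y x = Suc j" "k - Suc (visits t y x) = j"
          by (metis Suc_diff_Suc)
        show ?thesis using True \<open>y t = x\<close> by (simp add: h_def V_def j)
      next
        case False
        with \<open>y t = x\<close> V0[of t y] show ?thesis by (simp add: h_def)
      qed
    next
      case False
      then have "(\<Sum>z\<in>UNIV. Q $ y t $ z * h y z) = (\<Sum>z\<in>UNIV. Q $ y t $ z) * V t y"
        by (simp add: h_def sum_distrib_right)
      with p[of "y t"] show ?thesis by (simp add: prob_vec_def)
    qed
    have dsum: "depends_upto t (\<lambda>y. \<Sum>z\<in>UNIV. Q $ y t $ z * h y z)"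
      unfolding depends_upto_def
    proof safe
      fix y y' :: "nat \<Rightarrow> 'x" assume *: "\<forall>i\<in>{1..t}. y i = y' i"
      then have "h y z = h y' z" for z by (intro depends_uptoD[OF dh]) auto
      with * Suc.hyps show "(\<Sum>z\<in>UNIV. Q $ y t $ z * h y z) = (\<Sum>z\<in>UNIV. Q $ y' t $ z * h y' z)" by simp
    qed
    have "expectation (\<lambda>\<omega>. V (Suc t) (\<lambda>i. Y i \<omega>)) =
        expectation (\<lambda>\<omega>. \<Sum>z\<in>UNIV. Q $ Y t \<omega> $ z * h (\<lambda>i. Y i \<omega>) z)"
      unfolding Vh using Y Suc.hyps Suc.prems dh by (simp add: markov_process_def)
    also have "\<dots> \<le> expectation (\<lambda>\<omega>. V t (\<lambda>i. Y i \<omega>))"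
      using meas Suc.prems le
      by (intro integral_mono integrable_depends_upto[OF _ dsum] integrable_depends_upto[OF _ dV]) auto
    also have "\<dots> \<le> iid_expect (Q $ x) k g (\<lambda>_. 0)"
      using Suc by simp
    finally show ?case .
  qed
  from this[OF n] have "expectation (\<lambda>\<omega>. V n (\<lambda>i. Y i \<omega>)) \<le> iid_expect (Q $ x) k g (\<lambda>_. 0)" by simp
  \<comment> \<open>With exactly \<open>k\<close> visits no fresh sample is left, so
    \<open>V n\<close> is \<open>g\<close> at the counts; otherwise it is nonnegative.\<close>
  moreover have "expectation (\<lambda>\<omega>. of_bool (visits n (\<lambda>i. Y i \<omega>) x = k) * g (transitions n (\<lambda>i. Y i \<omega>) x))
      \<le> expectation (\<lambda>\<omega>. V n (\<lambda>i. Y i \<omega>))"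
  proof -
    have d: "depends_upto n (\<lambda>y. of_bool (visits n y x = k) * g (transitions n y x))"
      using depends_upto_visits[of n x] depends_upto_transitions[of n x]
      unfolding depends_upto_def by metis
    show ?thesis
      by (intro integral_mono integrable_depends_upto[OF meas d] integrable_depends_upto[OF meas dV])
        (auto simp: V_def intro: iid_expect_nonneg[OF p g])
  qed
  ultimately show ?thesis by simp
qed

text \<open>The number of visits is random, so the union bound runs over its possible values
  \<open>k\<close> as well as over the states; for fixed \<open>k\<close> the comparison with an
  i.i.d. sample applies.\<close>

lemma markov_process_excess_dev:
  fixes Q :: "real ^ 'x ^ 'x::finite"
  assumes Y: "markov_process n Q Y" and Q: "row_stochastic Q" and n: "1 \<le> n" and L: "0 \<le> L"
  shows "prob {\<omega> \<in> space M. \<exists>x. 3 * sqrt 2 * sqrt (visits n (\<lambda>i. Y i \<omega>) x) * sqrt L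
      < excess_dev (Q $ x) (visits n (\<lambda>i. Y i \<omega>) x) (transitions n (\<lambda>i. Y i \<omega>) x)}
    \<le> real n * real CARD('x) * exp (- L)"
proof -
  have meas: "Y i \<in> measurable M (count_space UNIV)" if "1 \<le> i" "i \<le> n" for i
    using Y that by (auto simp: markov_process_def)
  define \<Phi> where "\<Phi> x k y \<longleftrightarrow> visits n y x = k \<and>
    3 * sqrt 2 * sqrt k * sqrt L < excess_dev (Q $ x) k (transitions n y x)" for x :: 'x and k y
  define E where "E = (\<lambda>(x, k). {\<omega> \<in> space M. \<Phi> x k (\<lambda>i. Y i \<omega>)})"
  have "depends_upto n (\<Phi> x k)" for x k
    using depends_upto_visits[of n x] depends_upto_transitions[of n x]
    unfolding depends_upto_def \<Phi>_def by metis
  from sets_depends_upto[OF _ this] meas have E: "E xk \<in> events" for xk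
    by (cases xk) (auto simp: E_def)
  have le: "prob (E (x, k)) \<le> exp (- L)" if "0 < k" for x k
  proof -
    let ?g = "\<lambda>c. of_bool (3 * sqrt 2 * sqrt k * sqrt L < excess_dev (Q $ x) k c) :: real"
    have "prob (E (x, k)) = expectation (indicator (E (x, k)))" using E by simp
    also have "\<dots> = expectation (\<lambda>\<omega>. of_bool (visits n (\<lambda>i. Y i \<omega>) x = k) * ?g (transitions n (\<lambda>i. Y i \<omega>) x))"
      by (intro Bochner_Integration.integral_cong) (auto simp: E_def \<Phi>_def indicator_def)
    also have "\<dots> \<le> iid_expect (Q $ x) k ?g (\<lambda>_. 0)"
      by (rule markov_process_successors[OF Y Q n]) simp
    also have "\<dots> \<le> exp (- L)"
      using Q that L by (intro iid_excess_dev_tail) (auto simp: row_stochastic_def)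
    finally show ?thesis .
  qed
  \<comment> \<open>An unvisited state makes both sides 0, so the strict inequality fails and only
    \<open>k\<close> in \<open>{1..<n}\<close> remains.\<close>
  have E0: "excess_dev (Q $ x) (visits n y x) (transitions n y x) = 0" if "visits n y x = 0" for x y
    using that sum_transitions[of n y x] by (simp add: excess_dev_def)
  have "{\<omega> \<in> space M. \<exists>x. 3 * sqrt 2 * sqrt (visits n (\<lambda>i. Y i \<omega>) x) * sqrt L
      < excess_dev (Q $ x) (visits n (\<lambda>i. Y i \<omega>) x) (transitions n (\<lambda>i. Y i \<omega>) x)}
    \<subseteq> (\<Union>xk\<in>UNIV \<times> {1..<n}. E xk)" (is "?B \<subseteq> _")
  proof
    fix \<omega> assume "\<omega> \<in> ?B"
    then obtain x where x: "\<omega> \<in> space M"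
      "3 * sqrt 2 * sqrt (visits n (\<lambda>i. Y i \<omega>) x) * sqrt L
        < excess_dev (Q $ x) (visits n (\<lambda>i. Y i \<omega>) x) (transitions n (\<lambda>i. Y i \<omega>) x)" by auto
    have "visits n (\<lambda>i. Y i \<omega>) x \<noteq> 0"
    proof
      assume 0: "visits n (\<lambda>i. Y i \<omega>) x = 0"
      show False using x(2) E0[OF 0] 0 by simp
    qed
    then have "(x, visits n (\<lambda>i. Y i \<omega>) x) \<in> UNIV \<times> {1..<n}"
      using visits_less[OF n] by (simp add: Suc_le_eq)
    moreover have "\<omega> \<in> E (x, visits n (\<lambda>i. Y i \<omega>) x)"
      using x by (simp add: E_def \<Phi>_def)
    ultimately show "\<omega> \<in> (\<Union>xk\<in>UNIV \<times> {1..<n}. E xk)" by (rule UN_I)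
  qed
  then have "prob ?B \<le> prob (\<Union>xk\<in>UNIV \<times> {1..<n}. E xk)"
    using E by (intro finite_measure_mono sets.finite_UN) auto
  also have "\<dots> \<le> (\<Sum>xk\<in>UNIV \<times> {1..<n}. prob (E xk))"
    using E by (intro finite_measure_subadditive_finite) auto
  also have "\<dots> \<le> (\<Sum>xk\<in>(UNIV :: 'x set) \<times> {1..<n}. exp (- L))"
    using le by (intro sum_mono) auto
  also have "\<dots> = real (CARD('x) * (n - 1)) * exp (- L)"
    by (simp add: card_cartesian_product)
  also have "\<dots> \<le> real n * real CARD('x) * exp (- L)"
    using n by (intro mult_right_mono) (auto simp: mult.commute of_nat_diff)
  finally show ?thesis .
qed

end

section \<open>Deterministic error bounds\<close>

lemma depends_upto_P_hat: "depends_upto n (P_hat lam n)"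
  unfolding depends_upto_def
proof safe
  fix y y' :: "nat \<Rightarrow> 'a" assume "\<forall>i\<in>{1..n}. y i = y' i"
  then have "visits n y = visits n y'" "transitions n y = transitions n y'"
    by (auto intro!: ext depends_uptoD[OF depends_upto_visits] depends_uptoD[OF depends_upto_transitions, THEN fun_cong])
  then show "P_hat lam n y = P_hat lam n y'" by (simp add: P_hat_def)
qed

lemma depends_upto_W_hat: "depends_upto n (W_hat lam \<delta> n)"
  unfolding depends_upto_def
proof safe
  fix y y' :: "nat \<Rightarrow> 'a" assume "\<forall>i\<in>{1..n}. y i = y' i"
  then have "visits n y = visits n y'" "transitions n y = transitions n y'"
    by (auto intro!: ext depends_uptoD[OF depends_upto_visits] depends_uptoD[OF depends_upto_transitions, THEN fun_cong])
  then show "W_hat lam \<delta> n y = W_hat lam \<delta> n y'" by (simp add: W_hat_def)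
qed

lemma depends_upto_comp: "depends_upto t f \<Longrightarrow> depends_upto t (\<lambda>y. g (f y))"
  unfolding depends_upto_def by (intro allI impI arg_cong[where f = g]) blast

lemma depends_upto_skip:
  assumes m: "1 \<le> m" and f: "depends_upto (skip_len s m) f"
  shows "depends_upto m (\<lambda>y. f (skip s y))"
  unfolding depends_upto_def
proof safe
  fix y y' :: "nat \<Rightarrow> 'a" assume *: "\<forall>i\<in>{1..m}. y i = y' i"
  show "f (skip s y) = f (skip s y')"
  proof (rule depends_uptoD[OF f])
    fix i assume "1 \<le> i" "i \<le> skip_len s m"
    then have "1 + (i - 1) * s \<le> m" using skip_index_le[OF m] by blast
    with * show "skip s y i = skip s y' i" by (simp add: skip_def)
  qed
qed

lemma depends_upto_kappa_hat_skip: "1 \<le> m \<Longrightarrow> depends_upto m (kappa_hat_skip s lam m)"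
  unfolding kappa_hat_skip_def
  by (rule depends_upto_skip[where f = "\<lambda>y. contraction_coeff (P_hat lam (skip_len s m) y)"])
    (assumption, rule depends_upto_comp[OF depends_upto_P_hat])

lemma depends_upto_W_hat_skip: "1 \<le> m \<Longrightarrow> depends_upto m (W_hat_skip s lam \<delta> m)"
  unfolding W_hat_skip_def by (rule depends_upto_skip[OF _ depends_upto_W_hat])

section \<open>Propagation of the matrix error to the contraction coefficients\<close>

text \<open>The pair attaining the coefficient of \<open>A\<close> is tested on \<open>B\<close>.
  Each of the two image distributions moves by at most \<open>D\<close> in \<open>l1\<close>, and
  the factor 1/2 of \<open>tv_dist\<close> turns \<open>2 * D\<close> into \<open>D\<close>.\<close>

lemma contraction_coeff_diff_le:
  fixes A B :: "real ^ 'x ^ 'x::finite"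
  assumes D: "\<And>x. (\<Sum>y\<in>UNIV. \<bar>A $ x $ y - B $ x $ y\<bar>) \<le> D"
  shows "contraction_coeff A - contraction_coeff B \<le> D"
proof -
  obtain \<mu> \<nu> where mn: "prob_vec \<mu>" "prob_vec \<nu>" "contraction_coeff A = tv_dist (\<mu> v* A) (\<nu> v* A)"
    using contraction_coeff_attained by blast
  have B: "tv_dist (\<mu> v* B) (\<nu> v* B) \<le> contraction_coeff B"
    using contraction_coeff_attained[of B] mn by blast
  have row: "(\<Sum>y\<in>UNIV. \<bar>(p v* A) $ y - (p v* B) $ y\<bar>) \<le> D" if p: "prob_vec p" for p
  proof -
    have "(\<Sum>y\<in>UNIV. \<bar>(p v* A) $ y - (p v* B) $ y\<bar>) = (\<Sum>y\<in>UNIV. \<bar>\<Sum>x\<in>UNIV. p $ x * (A $ x $ y - B $ x $ y)\<bar>)"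
      by (simp add: vector_matrix_mult_def sum_subtractf right_diff_distrib mult.commute)
    also have "\<dots> \<le> (\<Sum>y\<in>UNIV. \<Sum>x\<in>UNIV. p $ x * \<bar>A $ x $ y - B $ x $ y\<bar>)"
      using p by (intro sum_mono order_trans[OF sum_abs]) (simp add: abs_mult prob_vec_def)
    also have "\<dots> = (\<Sum>x\<in>UNIV. p $ x * (\<Sum>y\<in>UNIV. \<bar>A $ x $ y - B $ x $ y\<bar>))"
      unfolding sum_distrib_left by (rule sum.swap)
    also have "\<dots> \<le> (\<Sum>x\<in>UNIV. p $ x * D)"
      using p D by (intro sum_mono mult_left_mono) (auto simp: prob_vec_def)
    also have "\<dots> = D" using p by (simp add: prob_vec_def flip: sum_distrib_right)
    finally show ?thesis .
  qed
  have "(\<Sum>y\<in>UNIV. \<bar>(\<mu> v* A) $ y - (\<nu> v* A) $ y\<bar>) \<le>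
      (\<Sum>y\<in>UNIV. \<bar>(\<mu> v* B) $ y - (\<nu> v* B) $ y\<bar> + \<bar>(\<mu> v* A) $ y - (\<mu> v* B) $ y\<bar>
        + \<bar>(\<nu> v* A) $ y - (\<nu> v* B) $ y\<bar>)"
    by (intro sum_mono) linarith
  then show ?thesis
    using row[OF mn(1)] row[OF mn(2)] B mn(3) by (simp add: tv_dist_def sum.distrib)
qed

lemma contraction_coeff_lipschitz:
  fixes A B :: "real ^ 'x ^ 'x::finite"
  assumes "\<And>x. (\<Sum>y\<in>UNIV. \<bar>A $ x $ y - B $ x $ y\<bar>) \<le> D"
  shows "\<bar>contraction_coeff A - contraction_coeff B\<bar> \<le> D"
proof -
  have "(\<Sum>y\<in>UNIV. \<bar>B $ x $ y - A $ x $ y\<bar>) \<le> D" for x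
    using assms[of x] by (subst abs_minus_commute)
  then have "contraction_coeff B - contraction_coeff A \<le> D" by (rule contraction_coeff_diff_le)
  moreover have "contraction_coeff A - contraction_coeff B \<le> D" by (rule contraction_coeff_diff_le[OF assms])
  ultimately show ?thesis by linarith
qed

text \<open>Over the common denominator the error splits into the count deviation and the smoothing
  part \<open>lam $ x * (1 - d * Q $ x $ z)\<close>, whose absolute values sum to at most
  \<open>2 * lam $ x * d\<close>. Both fit under the factor 2 of \<open>W_hat\<close>.\<close>

lemma P_hat_row_le_W_hat:
  fixes Q :: "real ^ 'x ^ 'x::finite"
  assumes Q: "row_stochastic Q" and lam: "\<And>x. 0 < lam $ x"
    and dev: "excess_dev (Q $ x) (visits n y x) (transitions n y x)
      \<le> 3 * sqrt 2 * sqrt (visits n y x) * sqrt (ln (2 * real n * real CARD('x) / \<delta>))"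
  shows "(\<Sum>z\<in>UNIV. \<bar>P_hat lam n y $ x $ z - Q $ x $ z\<bar>) \<le> W_hat lam \<delta> n y"
proof -
  define N where "N = real (visits n y x)"
  define d where "d = real CARD('x)"
  define R where "R = sqrt (ln (2 * real n * d / \<delta>))"
  define S where "S = (\<Sum>z\<in>UNIV. sqrt (real (transitions n y x z)))"
  have d: "1 \<le> d" unfolding d_def using zero_less_card_finite[where 'a = 'x] by linarith
  have N: "0 \<le> N" by (simp add: N_def)
  have pos: "0 < N + lam $ x * d" using lam[of x] d N by (simp add: add_nonneg_pos)
  have q: "0 \<le> Q $ x $ z" "(\<Sum>z\<in>UNIV. Q $ x $ z) = 1" for z
    using Q by (auto simp: row_stochastic_def prob_vec_def)
  have entry: "\<bar>P_hat lam n y $ x $ z - Q $ x $ z\<bar> \<le>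
      (\<bar>real (transitions n y x z) - N * Q $ x $ z\<bar> + lam $ x * (1 + d * Q $ x $ z)) / (N + lam $ x * d)" for z
  proof -
    have "P_hat lam n y $ x $ z - Q $ x $ z =
        ((real (transitions n y x z) - N * Q $ x $ z) + lam $ x * (1 - d * Q $ x $ z)) / (N + lam $ x * d)"
      using pos unfolding P_hat_def N_def[symmetric] d_def[symmetric] by (simp add: field_simps N_def)
    also have "\<bar>\<dots>\<bar> = \<bar>(real (transitions n y x z) - N * Q $ x $ z) + lam $ x * (1 - d * Q $ x $ z)\<bar> / (N + lam $ x * d)"
      using pos by simp
    also have "\<dots> \<le> (\<bar>real (transitions n y x z) - N * Q $ x $ z\<bar> + lam $ x * (1 + d * Q $ x $ z)) / (N + lam $ x * d)"
    proof (intro divide_right_mono order_trans[OF abs_triangle_ineq] add_left_mono)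
      have "\<bar>1 - d * Q $ x $ z\<bar> \<le> 1 + d * Q $ x $ z" using q(1)[of z] d by (simp add: abs_le_iff)
      then show "\<bar>lam $ x * (1 - d * Q $ x $ z)\<bar> \<le> lam $ x * (1 + d * Q $ x $ z)"
        using lam[of x] by (simp add: abs_mult)
    qed (use pos in auto)
    finally show ?thesis .
  qed
  have "(\<Sum>z\<in>UNIV. \<bar>P_hat lam n y $ x $ z - Q $ x $ z\<bar>) \<le>
      (\<Sum>z\<in>UNIV. (\<bar>real (transitions n y x z) - N * Q $ x $ z\<bar> + lam $ x * (1 + d * Q $ x $ z)) / (N + lam $ x * d))"
    by (intro sum_mono entry)
  also have "\<dots> = ((\<Sum>z\<in>UNIV. \<bar>real (transitions n y x z) - N * Q $ x $ z\<bar>) + 2 * lam $ x * d) / (N + lam $ x * d)"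
    using q(2) by (simp add: sum.distrib d_def algebra_simps flip: sum_divide_distrib sum_distrib_left)
  also have "\<dots> \<le> (2 * (S + (3 / sqrt 2) * sqrt N * R + lam $ x * d)) / (N + lam $ x * d)"
  proof (intro divide_right_mono)
    have "2 * (3 / sqrt 2) = 3 * sqrt (2 :: real)"
      using real_div_sqrt[of 2] by simp
    then have "2 * ((3 / sqrt 2) * sqrt N * R) = 3 * sqrt 2 * sqrt N * R"
      by (metis mult.assoc)
    then show "(\<Sum>z\<in>UNIV. \<bar>real (transitions n y x z) - N * Q $ x $ z\<bar>) + 2 * lam $ x * d
        \<le> 2 * (S + (3 / sqrt 2) * sqrt N * R + lam $ x * d)"
      using dev unfolding excess_dev_def sum_subtractf N_def[symmetric] d_def[symmetric] R_def[symmetric]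
      by (simp add: S_def algebra_simps flip: sum_distrib_left)
  qed (use pos in auto)
  also have "\<dots> \<le> W_hat lam \<delta> n y"
    unfolding W_hat_def times_divide_eq_right[symmetric]
    by (intro mult_left_mono Max_ge) (auto simp: S_def N_def R_def d_def)
  finally show ?thesis .
qed

text \<open>At every state the numerator is at least \<open>sqrt N + a\<close>, while
  \<open>N + a \<le> sqrt n * (sqrt N + a)\<close> because \<open>N \<le> n\<close> and
  \<open>1 \<le> n\<close>.\<close>

lemma W_hat_ge:
  fixes y :: "nat \<Rightarrow> 'x::finite"
  assumes lam: "\<And>x. 0 < lam $ x" and n: "1 \<le> n" and \<delta>: "0 < \<delta>" "\<delta> \<le> 1"
  shows "1 / sqrt n \<le> W_hat lam \<delta> n y"
proof -
  \<comment> \<open>Any state will do, since the maximum dominates each of its terms.\<close>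
  define x :: 'x where "x = undefined"
  define N where "N = real (visits n y x)"
  define a where "a = lam $ x * real CARD('x)"
  define R where "R = sqrt (ln (2 * real n * real CARD('x) / \<delta>))"
  define S where "S = (\<Sum>z\<in>UNIV. sqrt (real (transitions n y x z)))"
  have a: "0 < a" unfolding a_def using lam[of x] zero_less_card_finite[where 'a = 'x] by simp
  have N: "0 \<le> N" "N \<le> n" unfolding N_def using visits_less[OF n, of y x] by auto
  have "\<delta> \<le> 2 * real n * real CARD('x)"
  proof -
    have "1 * 1 \<le> real n * real CARD('x)"
      using n zero_less_card_finite[where 'a = 'x] by (intro mult_mono) auto
    then show ?thesis using \<delta> by linarith
  qed
  then have R: "0 \<le> R" unfolding R_def using \<delta> by simp
  \<comment> \<open>Here \<open>sqrt N\<close> is the \<open>l2\<close> norm of the vector of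
    square-rooted transition counts, and \<open>S\<close> is its \<open>l1\<close> norm.\<close>
  have "sqrt N = sqrt (\<Sum>z\<in>UNIV. (sqrt (real (transitions n y x z)))\<^sup>2)"
    unfolding N_def sum_transitions[of n y x, symmetric] by simp
  also have "\<dots> \<le> S"
    unfolding S_def using L2_set_le_sum[of UNIV "\<lambda>z. sqrt (real (transitions n y x z))"]
    by (simp add: L2_set_def)
  finally have S: "sqrt N \<le> S" .
  have "N + a \<le> sqrt n * (S + (3 / sqrt 2) * sqrt N * R + a)"
  proof -
    have "N = sqrt N * sqrt N" using N by simp
    also have "\<dots> \<le> sqrt n * S" using N S by (intro mult_mono) auto
    finally have "N \<le> sqrt n * S" .
    moreover have "1 * a \<le> sqrt n * a" using n a by (intro mult_right_mono) auto
    moreover have "0 \<le> sqrt n * ((3 / sqrt 2) * sqrt N * R)" using R N by simp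
    ultimately show ?thesis by (simp add: distrib_left)
  qed
  then have "1 / sqrt n \<le> (S + (3 / sqrt 2) * sqrt N * R + a) / (N + a)"
    using a N n by (simp add: divide_simps mult.commute)
  also have "\<dots> \<le> (MAX x.
       ((\<Sum>x'\<in>UNIV. sqrt (real (transitions n y x x')))
         + (3 / sqrt 2) * sqrt (real (visits n y x)) * sqrt (ln (2 * real n * real CARD('x) / \<delta>))
         + lam $ x * real CARD('x))
       / (real (visits n y x) + lam $ x * real CARD('x)))" (is "_ \<le> ?M")
    by (intro Max_ge) (auto simp: S_def N_def R_def a_def)
  finally have "1 / sqrt n \<le> ?M" .
  moreover have "0 \<le> 1 / sqrt n" by simp
  ultimately show ?thesis unfolding W_hat_def by linarith
qed

text \<open>The term \<open>s = 1\<close>, for the unskipped sequence of length \<open>m\<close>,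
  already makes the maximum at least \<open>1 / sqrt m\<close>. Its positivity gives the lower bound
  on \<open>S_hat\<close>.\<close>

lemma S_hat_bounds:
  fixes y :: "nat \<Rightarrow> 'x::finite"
  assumes lam: "\<And>x. 0 < lam $ x" and m: "1 \<le> m" and \<delta>: "0 < \<delta>" "\<delta> \<le> 1" and \<phi>: "1 \<le> \<phi> m"
  shows "1 \<le> S_hat \<phi> lam \<delta> m y" "S_hat \<phi> lam \<delta> m y \<le> nat \<lceil>sqrt m\<rceil>"
proof -
  define W where "W = (MAX s\<in>{1..\<phi> m}. 1 / real s * W_hat_skip s lam \<delta> m y)"
  have "1 / sqrt m \<le> 1 / real 1 * W_hat_skip 1 lam \<delta> m y"
    using W_hat_ge[OF lam m \<delta>, of "skip 1 y"] m by (simp add: W_hat_skip_def skip_len_def)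
  also have "\<dots> \<le> W"
    unfolding W_def using \<phi> by (intro Max_ge image_eqI[where x = 1]) auto
  finally have W: "1 / sqrt m \<le> W" .
  have sm: "0 < sqrt m" using m by simp
  then have "0 < W" using W by (smt (verit) divide_pos_pos)
  then show "1 \<le> S_hat \<phi> lam \<delta> m y" unfolding S_hat_def W_def[symmetric]
    by (simp add: Suc_le_eq)
  have "1 / W \<le> sqrt m" using W \<open>0 < W\<close> sm by (simp add: field_simps)
  then show "S_hat \<phi> lam \<delta> m y \<le> nat \<lceil>sqrt m\<rceil>" unfolding S_hat_def W_def[symmetric]
    by (intro nat_mono ceiling_mono)
qed

text \<open>Up to \<open>S\<close> the two maxima are compared termwise, with error at most
  \<open>W\<close>. If the true maximum is attained beyond \<open>S\<close>, it is at most
  \<open>1 / S\<close>.\<close>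

lemma kappa_hat_trunc_error:
  fixes P :: "real ^ 'x ^ 'x::finite"
  assumes P: "row_stochastic P" and S: "1 \<le> S"
    and s: "\<And>s. s \<in> {1..S} \<Longrightarrow>
      \<bar>kappa_hat_skip s lam m y - contraction_coeff (mat_pow P s)\<bar> \<le> W_hat_skip s lam (\<delta> / S) m y"
  shows "\<bar>kappa_hat_trunc lam S m y - gen_contraction_coeff P\<bar> \<le> K_hat_trunc lam \<delta> S m y"
proof -
  define f where "f s = (1 - kappa_hat_skip s lam m y) / real s" for s
  define g where "g s = (1 - contraction_coeff (mat_pow P s)) / real s" for s
  define W where "W = (MAX s\<in>{1..S}. 1 / real s * W_hat_skip s lam (\<delta> / S) m y)"
  define F where "F = (MAX s\<in>{1..S}. f s)"
  have ne: "f ` {1..S} \<noteq> {}" using S by auto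
  have fg: "\<bar>f s - g s\<bar> \<le> W" if "s \<in> {1..S}" for s
  proof -
    have "f s - g s = - (kappa_hat_skip s lam m y - contraction_coeff (mat_pow P s)) / real s"
      by (simp add: f_def g_def flip: diff_divide_distrib)
    then have "\<bar>f s - g s\<bar> = \<bar>kappa_hat_skip s lam m y - contraction_coeff (mat_pow P s)\<bar> / real s"
      by (simp add: abs_minus_commute)
    also have "\<dots> \<le> W_hat_skip s lam (\<delta> / S) m y / real s"
      by (intro divide_right_mono s that) simp
    also have "\<dots> = 1 / real s * W_hat_skip s lam (\<delta> / S) m y" by simp
    also have "\<dots> \<le> W" unfolding W_def using that by (intro Max_ge) auto
    finally show ?thesis .
  qed
  obtain t where t: "1 \<le> t" "gen_contraction_coeff P = 1 - g t" "\<And>r. 1 \<le> r \<Longrightarrow> g r \<le> g t"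
    using gen_contraction_coeff_attained[OF P] unfolding g_def by blast
  have F_ge: "f s \<le> F" if "s \<in> {1..S}" for s unfolding F_def using that by (intro Max_ge) auto
  have g0: "0 \<le> g s" for s
    using contraction_coeff_le_1[OF row_stochastic_mat_pow[OF P, of s]] by (simp add: g_def)
  obtain r where r: "r \<in> {1..S}" "F = f r"
    using Max_in[OF _ ne] by (auto simp: F_def)
  have up: "F \<le> g t + W"
    using fg[OF r(1)] t(3)[of r] r(2) r(1)[unfolded atLeastAtMost_iff] by linarith
  have S0: "0 \<le> 1 / real S" by simp
  have "g t \<le> F + (1 / S + W)"
  proof (cases "t \<le> S")
    case True
    then have "t \<in> {1..S}" using t by simp
    from fg[OF this] F_ge[OF this] S0 show ?thesis by linarith
  next
    case False
    have "g t \<le> 1 / t" using contraction_coeff_nonneg[of "mat_pow P t"] t(1)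
      by (simp add: g_def divide_right_mono)
    also have "\<dots> \<le> 1 / S" using False S by (intro divide_left_mono) auto
    finally have "g t \<le> 1 / S" .
    \<comment> \<open>Obtained from \<open>0 \<le> g r\<close> and the error bound at the empirical
      maximizer \<open>r\<close>.\<close>
    moreover have "0 \<le> F + W" using fg[OF r(1)] g0[of r] r(2) by linarith
    ultimately show ?thesis by linarith
  qed
  then have "\<bar>(1 - F) - (1 - g t)\<bar> \<le> 1 / S + W" using up S0 by linarith
  then show ?thesis
    unfolding kappa_hat_trunc_def K_hat_trunc_def t(2) f_def[symmetric] F_def[symmetric] W_def[symmetric] .
qed

section \<open>Concentration of the estimators\<close>

context prob_space begin

text \<open>Outside the event that some row of the skipped chain has a large excess deviation, every
  row error is at most \<open>W_hat\<close>, and hence so is the error of the coefficient.\<close>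

lemma kappa_hat_skip_error:
  fixes P :: "real ^ 'x ^ 'x::finite"
  assumes P: "row_stochastic P" and traj: "markov_trajectory M m \<mu> P X" and m: "1 \<le> m" and s: "1 \<le> s"
    and \<delta>: "0 < \<delta>" "\<delta> \<le> 1" and lam: "\<And>x. 0 < lam $ x"
  shows "prob {\<omega> \<in> space M. W_hat_skip s lam \<delta> m (\<lambda>t. X t \<omega>)
      < \<bar>kappa_hat_skip s lam m (\<lambda>t. X t \<omega>) - contraction_coeff (mat_pow P s)\<bar>} \<le> \<delta>"
proof -
  let ?n = "skip_len s m" and ?Q = "mat_pow P s"
  define L where "L = ln (2 * real ?n * real CARD('x) / \<delta>)"
  have n: "1 \<le> ?n" by (simp add: skip_len_def)
  have c: "1 * 1 \<le> real ?n * real CARD('x)"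
    using n zero_less_card_finite[where 'a = 'x] by (intro mult_mono) auto
  then have L: "0 \<le> L" using \<delta> by (simp add: L_def)
  have Q: "row_stochastic ?Q" by (rule row_stochastic_mat_pow[OF P])
  have Y: "markov_process ?n ?Q (skip s X)" by (rule markov_process_skip[OF P traj m s])
  have meas: "skip s X i \<in> measurable M (count_space UNIV)" if "1 \<le> i" "i \<le> ?n" for i
    using Y that by (auto simp: markov_process_def)
  define \<Phi> where "\<Phi> y \<longleftrightarrow> (\<exists>x. 3 * sqrt 2 * sqrt (visits ?n y x) * sqrt L
      < excess_dev (?Q $ x) (visits ?n y x) (transitions ?n y x))" for y
  have d: "depends_upto ?n \<Phi>"
    unfolding depends_upto_def
  proof (intro allI impI)
    fix y y' :: "nat \<Rightarrow> 'x" assume "\<forall>i\<in>{1..?n}. y i = y' i"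
    then have "visits ?n y x = visits ?n y' x" "transitions ?n y x = transitions ?n y' x" for x
      by (auto intro!: depends_uptoD[OF depends_upto_visits] depends_uptoD[OF depends_upto_transitions])
    then show "\<Phi> y = \<Phi> y'" by (simp add: \<Phi>_def)
  qed
  have sk: "skip s (\<lambda>t. X t \<omega>) = (\<lambda>i. skip s X i \<omega>)" for \<omega> by (simp add: skip_def)
  have "prob {\<omega> \<in> space M. W_hat_skip s lam \<delta> m (\<lambda>t. X t \<omega>)
      < \<bar>kappa_hat_skip s lam m (\<lambda>t. X t \<omega>) - contraction_coeff ?Q\<bar>}
    \<le> prob {\<omega> \<in> space M. \<Phi> (\<lambda>i. skip s X i \<omega>)}"
  proof (rule finite_measure_mono)
    show "{\<omega> \<in> space M. \<Phi> (\<lambda>i. skip s X i \<omega>)} \<in> events"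
      using meas by (intro sets_depends_upto[OF _ d]) auto
    have "\<bar>kappa_hat_skip s lam m y - contraction_coeff ?Q\<bar> \<le> W_hat_skip s lam \<delta> m y" if "\<not> \<Phi> (skip s y)" for y
      unfolding kappa_hat_skip_def W_hat_skip_def
    proof (intro contraction_coeff_lipschitz P_hat_row_le_W_hat Q lam)
      fix x
      show "excess_dev (?Q $ x) (visits ?n (skip s y) x) (transitions ?n (skip s y) x)
        \<le> 3 * sqrt 2 * sqrt (visits ?n (skip s y) x) * sqrt (ln (2 * real ?n * real CARD('x) / \<delta>))"
        using that unfolding \<Phi>_def L_def not_ex not_less by blast
    qed
    then show "{\<omega> \<in> space M. W_hat_skip s lam \<delta> m (\<lambda>t. X t \<omega>)
        < \<bar>kappa_hat_skip s lam m (\<lambda>t. X t \<omega>) - contraction_coeff ?Q\<bar>}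
      \<subseteq> {\<omega> \<in> space M. \<Phi> (\<lambda>i. skip s X i \<omega>)}"
      by (auto simp: not_less sk[symmetric]) (meson not_less)
  qed
  also have "\<dots> \<le> real ?n * real CARD('x) * exp (- L)"
    unfolding \<Phi>_def by (rule markov_process_excess_dev[OF Y Q n L])
  \<comment> \<open>The level \<open>L\<close> is chosen so that \<open>exp (- L)\<close> cancels
    the size of the union bound over states and visit counts.\<close>
  also have "\<dots> = \<delta> / 2"
  proof -
    have "0 < 2 * (real ?n * real CARD('x))" using c by linarith
    then have "0 < 2 * real ?n * real CARD('x) / \<delta>"
      unfolding mult.assoc by (rule divide_pos_pos[OF _ \<delta>(1)])
    then have "exp (- L) = \<delta> / (2 * (real ?n * real CARD('x)))" by (simp add: L_def exp_minus mult.assoc)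
    then show ?thesis using n by simp
  qed
  also have "\<dots> \<le> \<delta>" using \<delta> by simp
  finally show ?thesis .
qed

text \<open>Union bound over the \<open>S\<close> skips, each at level
  \<open>\<delta> / S\<close>.\<close>

lemma kappa_hat_trunc_concentration:
  fixes P :: "real ^ 'x ^ 'x::finite"
  assumes P: "row_stochastic P" and traj: "markov_trajectory M m \<mu> P X" and m: "1 \<le> m" and S: "1 \<le> S"
    and \<delta>: "0 < \<delta>" "\<delta> \<le> 1" and lam: "\<And>x. 0 < lam $ x"
  shows "prob {\<omega> \<in> space M. K_hat_trunc lam \<delta> S m (\<lambda>t. X t \<omega>)
      < \<bar>kappa_hat_trunc lam S m (\<lambda>t. X t \<omega>) - gen_contraction_coeff P\<bar>} \<le> \<delta>" (is "prob ?B \<le> _")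
proof -
  have meas: "X i \<in> measurable M (count_space UNIV)" if "1 \<le> i" "i \<le> m" for i
    using traj that by (auto simp: markov_trajectory_def)
  define \<Phi> where "\<Phi> s y \<longleftrightarrow> W_hat_skip s lam (\<delta> / S) m y
    < \<bar>kappa_hat_skip s lam m y - contraction_coeff (mat_pow P s)\<bar>" for s y
  have dep: "depends_upto m (\<Phi> s)" for s
    unfolding depends_upto_def
  proof (intro allI impI)
    fix y y' :: "nat \<Rightarrow> 'x" assume "\<forall>i\<in>{1..m}. y i = y' i"
    then have "kappa_hat_skip s lam m y = kappa_hat_skip s lam m y'"
      "W_hat_skip s lam (\<delta> / S) m y = W_hat_skip s lam (\<delta> / S) m y'"
      by (auto intro!: depends_uptoD[OF depends_upto_kappa_hat_skip[OF m]] depends_uptoD[OF depends_upto_W_hat_skip[OF m]])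
    then show "\<Phi> s y = \<Phi> s y'" by (simp add: \<Phi>_def)
  qed
  have E: "{\<omega> \<in> space M. \<Phi> s (\<lambda>t. X t \<omega>)} \<in> events" for s
    using meas by (intro sets_depends_upto[OF _ dep]) auto
  have "?B \<subseteq> (\<Union>s\<in>{1..S}. {\<omega> \<in> space M. \<Phi> s (\<lambda>t. X t \<omega>)})"
  proof safe
    fix \<omega> assume *: "\<omega> \<in> space M" "K_hat_trunc lam \<delta> S m (\<lambda>t. X t \<omega>)
      < \<bar>kappa_hat_trunc lam S m (\<lambda>t. X t \<omega>) - gen_contraction_coeff P\<bar>"
    have "\<exists>s\<in>{1..S}. \<Phi> s (\<lambda>t. X t \<omega>)"
    proof (rule ccontr)
      assume "\<not> ?thesis"
      then have "\<bar>kappa_hat_trunc lam S m (\<lambda>t. X t \<omega>) - gen_contraction_coeff P\<bar> \<le> K_hat_trunc lam \<delta> S m (\<lambda>t. X t \<omega>)"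
        by (intro kappa_hat_trunc_error P S) (auto simp: \<Phi>_def not_less)
      with * show False by simp
    qed
    with * show "\<omega> \<in> (\<Union>s\<in>{1..S}. {\<omega> \<in> space M. \<Phi> s (\<lambda>t. X t \<omega>)})" by blast
  qed
  then have "prob ?B \<le> prob (\<Union>s\<in>{1..S}. {\<omega> \<in> space M. \<Phi> s (\<lambda>t. X t \<omega>)})"
    using E by (intro finite_measure_mono sets.finite_UN) auto
  also have "\<dots> \<le> (\<Sum>s\<in>{1..S}. prob {\<omega> \<in> space M. \<Phi> s (\<lambda>t. X t \<omega>)})"
    using E by (intro finite_measure_subadditive_finite) auto
  also have "\<dots> \<le> (\<Sum>s\<in>{1..S}. \<delta> / S)"
  proof (intro sum_mono)
    fix s assume "s \<in> {1..S}"
    moreover have "\<delta> / S \<le> 1" "0 < \<delta> / S" using S \<delta> by auto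
    ultimately show "prob {\<omega> \<in> space M. \<Phi> s (\<lambda>t. X t \<omega>)} \<le> \<delta> / S"
      unfolding \<Phi>_def by (intro kappa_hat_skip_error[OF P traj m _ _ _ lam]) auto
  qed
  also have "\<dots> = \<delta>" using S by simp
  finally show ?thesis .
qed

text \<open>The truncation is random but lies in \<open>{1..R}\<close>, so all fixed truncations are
  controlled simultaneously, each at level \<open>\<delta> / R\<close>.\<close>

lemma kappa_hat_adaptive_concentration:
  fixes P :: "real ^ 'x ^ 'x::finite"
  assumes P: "row_stochastic P" and traj: "markov_trajectory M m \<mu> P X" and m: "1 \<le> m"
    and \<delta>: "0 < \<delta>" "\<delta> \<le> 1" and lam: "\<And>x. 0 < lam $ x" and \<phi>: "1 \<le> \<phi> m"
  shows "prob {\<omega> \<in> space M. K_hat_adaptive \<phi> lam \<delta> m (\<lambda>t. X t \<omega>)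
      < \<bar>kappa_hat_adaptive \<phi> lam \<delta> m (\<lambda>t. X t \<omega>) - gen_contraction_coeff P\<bar>} \<le> \<delta>" (is "prob ?B \<le> _")
proof -
  have meas: "X i \<in> measurable M (count_space UNIV)" if "1 \<le> i" "i \<le> m" for i
    using traj that by (auto simp: markov_trajectory_def)
  define R where "R = nat \<lceil>sqrt m\<rceil>"
  have sm: "0 < sqrt m" using m by simp
  then have R: "1 \<le> R" "real R = of_int \<lceil>sqrt m\<rceil>" by (auto simp: R_def Suc_le_eq)
  define \<Phi> where "\<Phi> S y \<longleftrightarrow> K_hat_trunc lam (\<delta> / R) S m y
      < \<bar>kappa_hat_trunc lam S m y - gen_contraction_coeff P\<bar>" for S y
  have dep: "depends_upto m (\<Phi> S)" for S
    unfolding depends_upto_def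
  proof (intro allI impI)
    fix y y' :: "nat \<Rightarrow> 'x" assume "\<forall>i\<in>{1..m}. y i = y' i"
    then have "kappa_hat_skip s lam m y = kappa_hat_skip s lam m y'"
      "W_hat_skip s lam (\<delta> / R / S) m y = W_hat_skip s lam (\<delta> / R / S) m y'" for s
      by (auto intro!: depends_uptoD[OF depends_upto_kappa_hat_skip[OF m]] depends_uptoD[OF depends_upto_W_hat_skip[OF m]])
    then show "\<Phi> S y = \<Phi> S y'" by (simp add: \<Phi>_def K_hat_trunc_def kappa_hat_trunc_def)
  qed
  have E: "{\<omega> \<in> space M. \<Phi> S (\<lambda>t. X t \<omega>)} \<in> events" for S
    using meas by (intro sets_depends_upto[OF _ dep]) auto
  have "?B \<subseteq> (\<Union>S\<in>{1..R}. {\<omega> \<in> space M. \<Phi> S (\<lambda>t. X t \<omega>)})"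
  proof safe
    fix \<omega> assume *: "\<omega> \<in> space M" "K_hat_adaptive \<phi> lam \<delta> m (\<lambda>t. X t \<omega>)
      < \<bar>kappa_hat_adaptive \<phi> lam \<delta> m (\<lambda>t. X t \<omega>) - gen_contraction_coeff P\<bar>"
    let ?S = "S_hat \<phi> lam \<delta> m (\<lambda>t. X t \<omega>)"
    have "?S \<in> {1..R}"
      using S_hat_bounds[where \<phi> = \<phi> and y = "\<lambda>t. X t \<omega>", OF lam m \<delta> \<phi>] by (simp add: R_def)
    \<comment> \<open>At the realized truncation the adaptive quantities are the fixed ones at level
      \<open>\<delta> / R\<close>, because
      \<open>\<delta> / R / S = \<delta> / (R * S)\<close>.\<close>
    moreover have "\<Phi> ?S (\<lambda>t. X t \<omega>)"
      using *(2) unfolding \<Phi>_def kappa_hat_adaptive_def K_hat_adaptive_def K_hat_trunc_def Let_def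
        divide_divide_eq_left R(2) .
    ultimately show "\<omega> \<in> (\<Union>S\<in>{1..R}. {\<omega> \<in> space M. \<Phi> S (\<lambda>t. X t \<omega>)})" using *(1) by blast
  qed
  then have "prob ?B \<le> prob (\<Union>S\<in>{1..R}. {\<omega> \<in> space M. \<Phi> S (\<lambda>t. X t \<omega>)})"
    using E by (intro finite_measure_mono sets.finite_UN) auto
  also have "\<dots> \<le> (\<Sum>S\<in>{1..R}. prob {\<omega> \<in> space M. \<Phi> S (\<lambda>t. X t \<omega>)})"
    using E by (intro finite_measure_subadditive_finite) auto
  also have "\<dots> \<le> (\<Sum>S\<in>{1..R}. \<delta> / R)"
  proof (intro sum_mono)
    fix S assume "S \<in> {1..R}"
    moreover have "\<delta> / R \<le> 1" "0 < \<delta> / R" using R(1) \<delta> by auto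
    ultimately show "prob {\<omega> \<in> space M. \<Phi> S (\<lambda>t. X t \<omega>)} \<le> \<delta> / R"
      unfolding \<Phi>_def by (intro kappa_hat_trunc_concentration[OF P traj m _ _ _ lam]) auto
  qed
  also have "\<dots> = \<delta>" using R(1) by simp
  finally show ?thesis .
qed

text \<open>Passage to the complement. Measurability of the good event matters, since a
  nonmeasurable set has measure 0 by convention.\<close>

lemma prob_le_event_ge:
  assumes "{\<omega> \<in> space M. f \<omega> \<le> g \<omega>} \<in> events" "prob {\<omega> \<in> space M. g \<omega> < (f \<omega> :: real)} \<le> \<delta>"
  shows "1 - \<delta> \<le> prob {\<omega> \<in> space M. f \<omega> \<le> g \<omega>}"
proof -
  have "{\<omega> \<in> space M. g \<omega> < f \<omega>} = space M - {\<omega> \<in> space M. f \<omega> \<le> g \<omega>}" by auto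
  with assms prob_compl[OF assms(1)] show ?thesis by simp
qed

end

theorem lemma4p1:
  fixes P :: "real ^ 'x ^ 'x::finite"
    and \<mu> :: "real ^ 'x"
    and lam :: "real ^ 'x"
    and \<delta> :: real
    and m :: nat
    and \<phi> :: "nat \<Rightarrow> nat"
    and M :: "'w measure"
    and X :: "nat \<Rightarrow> 'w \<Rightarrow> 'x"
  assumes "ergodic P"
    and "prob_vec \<mu>"
    and "0 < \<delta>" and "\<delta> < 1"
    and "\<And>x. 0 < lam $ x"
    and "m \<ge> 1"
    and "\<And>n. n \<ge> 1 \<Longrightarrow> \<phi> n \<ge> 1"
    and "mono_on {1..} \<phi>"
    and "filterlim \<phi> at_top at_top"
    and "prob_space M"
    and "markov_trajectory M m \<mu> P X"
  shows "(\<forall>S\<ge>1. measure M {\<omega> \<in> space M.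
            \<bar>kappa_hat_trunc lam S m (\<lambda>t. X t \<omega>) - gen_contraction_coeff P\<bar>
              \<le> K_hat_trunc lam \<delta> S m (\<lambda>t. X t \<omega>)} \<ge> 1 - \<delta>)
       \<and> measure M {\<omega> \<in> space M.
            \<bar>kappa_hat_adaptive \<phi> lam \<delta> m (\<lambda>t. X t \<omega>) - gen_contraction_coeff P\<bar>
              \<le> K_hat_adaptive \<phi> lam \<delta> m (\<lambda>t. X t \<omega>)} \<ge> 1 - \<delta>"
proof -
  interpret prob_space M by fact
  have P: "row_stochastic P" using \<open>ergodic P\<close> by (simp add: ergodic_def)
  have meas: "X i \<in> measurable M (count_space UNIV)" if "1 \<le> i" "i \<le> m" for i
    using \<open>markov_trajectory M m \<mu> P X\<close> that by (auto simp: markov_trajectory_def)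
  \<comment> \<open>Stated as equalities of functions, with every confidence level included, so that
    they rewrite under the maxima and at the data-dependent level of the adaptive width.\<close>
  have stats: "(\<lambda>s. kappa_hat_skip s lam m y) = (\<lambda>s. kappa_hat_skip s lam m y')"
    "(\<lambda>s d. W_hat_skip s lam d m y) = (\<lambda>s d. W_hat_skip s lam d m y')"
    if "\<forall>i\<in>{1..m}. y i = y' i" for y y' :: "nat \<Rightarrow> 'x"
    using that by (auto intro!: ext depends_uptoD[OF depends_upto_kappa_hat_skip[OF \<open>m \<ge> 1\<close>]]
      depends_uptoD[OF depends_upto_W_hat_skip[OF \<open>m \<ge> 1\<close>]])
  have d_trunc: "depends_upto m (\<lambda>y. \<bar>kappa_hat_trunc lam S m y - gen_contraction_coeff P\<bar> \<le> K_hat_trunc lam \<delta> S m y)" for S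
    unfolding depends_upto_def
  proof (intro allI impI)
    fix y y' :: "nat \<Rightarrow> 'x" assume "\<forall>i\<in>{1..m}. y i = y' i"
    from this[THEN stats(1), THEN fun_cong] this[THEN stats(2), THEN fun_cong, THEN fun_cong]
    show "(\<bar>kappa_hat_trunc lam S m y - gen_contraction_coeff P\<bar> \<le> K_hat_trunc lam \<delta> S m y) =
        (\<bar>kappa_hat_trunc lam S m y' - gen_contraction_coeff P\<bar> \<le> K_hat_trunc lam \<delta> S m y')"
      by (simp add: kappa_hat_trunc_def K_hat_trunc_def)
  qed
  have d_adaptive: "depends_upto m (\<lambda>y. \<bar>kappa_hat_adaptive \<phi> lam \<delta> m y - gen_contraction_coeff P\<bar> \<le> K_hat_adaptive \<phi> lam \<delta> m y)"
    unfolding depends_upto_def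
  proof (intro allI impI)
    fix y y' :: "nat \<Rightarrow> 'x" assume "\<forall>i\<in>{1..m}. y i = y' i"
    from this[THEN stats(1), THEN fun_cong] this[THEN stats(2), THEN fun_cong, THEN fun_cong]
    show "(\<bar>kappa_hat_adaptive \<phi> lam \<delta> m y - gen_contraction_coeff P\<bar> \<le> K_hat_adaptive \<phi> lam \<delta> m y) =
        (\<bar>kappa_hat_adaptive \<phi> lam \<delta> m y' - gen_contraction_coeff P\<bar> \<le> K_hat_adaptive \<phi> lam \<delta> m y')"
      by (simp add: kappa_hat_adaptive_def K_hat_adaptive_def S_hat_def kappa_hat_trunc_def)
  qed
  show ?thesis
  proof (intro conjI allI impI prob_le_event_ge)
    fix S :: nat assume "1 \<le> S"
    then show "prob {\<omega> \<in> space M. K_hat_trunc lam \<delta> S m (\<lambda>t. X t \<omega>)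
        < \<bar>kappa_hat_trunc lam S m (\<lambda>t. X t \<omega>) - gen_contraction_coeff P\<bar>} \<le> \<delta>"
      using assms P by (intro kappa_hat_trunc_concentration) auto
  next
    show "prob {\<omega> \<in> space M. K_hat_adaptive \<phi> lam \<delta> m (\<lambda>t. X t \<omega>)
        < \<bar>kappa_hat_adaptive \<phi> lam \<delta> m (\<lambda>t. X t \<omega>) - gen_contraction_coeff P\<bar>} \<le> \<delta>"
      using assms P by (intro kappa_hat_adaptive_concentration) auto
  qed (use sets_depends_upto[OF meas d_trunc] sets_depends_upto[OF meas d_adaptive] in auto)
qed

end
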